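(* Let $R$ be a proper subring of $\mathbb{Q}$, let $\Phi$ be a non-empty set of finite-rank-free-by-1 $R$-modules, and let $\kappa>|\Phi|$ be an infinite regular cardinal with $\kappa^{\aleph_0}=\kappa$. Then there exists a torsion-free, $\Phi$-complete, $\Phi$-represented $R$-module $G$ of rank $\kappa$. Moreover, if every module in $\Phi$ has rank at least $n+1$ (for a natural number $n$), then every $R$-submodule of $G$ of rank $\le n$ is free.
   Context: Let $R\subseteq\mathbb{Q}$ be a subring and $n\le\omega$. Let $B$ be the free $R$-module with basis $\{x_i:i<n\}\cup\{y_m:m\in\omega\}$, let $p_m\in R\setminus\{0\}$ and $k_{im}\in R$ with, for each $m$, $k_{im}=0$ for all but finitely many $i$, and let $N$ be the submodule generated by $y_{m+1}p_m-y_m-\sum_{i<n}x_ik_{im}$ $(m\in\omega)$. An $R$-module $G'$ is $n$-free-by-1 if $G'\cong B/N$ for such data, $G'$ is not free, and, if $n$ is finite, every $R$-submodule of $G'$ of rank $\le n$ is free; it is finite-rank-free-by-1 if it is $n$-free-by-1 for some finite $n$. For a set $\Phi$ of such modules: an $R$-module $L$ is $\Phi$-complete if $\mathrm{Ext}(G',L)=0$ for all $G'\in\Phi$; an $R$-module $G$ is $\Phi$-represented if $G=\bigcup_{\alpha<\lambda}G_\alpha$ for an ascending continuous chain of $R$-submodules with $G_0=0$ and each $G_{\alpha+1}/G_\alpha$ isomorphic to a member of $\Phi$ or to a free $R$-module. *)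

theory Defs
  imports Main "HOL-Library.Extended_Nat"
begin

definition subring_Q :: "rat set \<Rightarrow> bool" where
  "subring_Q R \<longleftrightarrow> 1 \<in> R \<and> (\<forall>a\<in>R. \<forall>b\<in>R. a + b \<in> R \<and> a - b \<in> R \<and> a * b \<in> R)"

record 'a rmod =
  mcarr :: "'a set"
  madd :: "'a \<Rightarrow> 'a \<Rightarrow> 'a"
  mzero :: "'a"
  msmul :: "rat \<Rightarrow> 'a \<Rightarrow> 'a"

definition rmodule :: "rat set \<Rightarrow> 'a rmod \<Rightarrow> bool" where
  "rmodule R M \<longleftrightarrow>
     mzero M \<in> mcarr M \<and>
     (\<forall>x\<in>mcarr M. \<forall>y\<in>mcarr M. madd M x y \<in> mcarr M) \<and>
     (\<forall>r\<in>R. \<forall>x\<in>mcarr M. msmul M r x \<in> mcarr M) \<and>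
     (\<forall>x\<in>mcarr M. \<forall>y\<in>mcarr M. \<forall>z\<in>mcarr M. madd M (madd M x y) z = madd M x (madd M y z)) \<and>
     (\<forall>x\<in>mcarr M. \<forall>y\<in>mcarr M. madd M x y = madd M y x) \<and>
     (\<forall>x\<in>mcarr M. madd M (mzero M) x = x) \<and>
     (\<forall>x\<in>mcarr M. \<exists>y\<in>mcarr M. madd M x y = mzero M) \<and>
     (\<forall>r\<in>R. \<forall>x\<in>mcarr M. \<forall>y\<in>mcarr M. msmul M r (madd M x y) = madd M (msmul M r x) (msmul M r y)) \<and>
     (\<forall>r\<in>R. \<forall>s\<in>R. \<forall>x\<in>mcarr M. msmul M (r + s) x = madd M (msmul M r x) (msmul M s x)) \<and>
     (\<forall>r\<in>R. \<forall>s\<in>R. \<forall>x\<in>mcarr M. msmul M (r * s) x = msmul M r (msmul M s x)) \<and>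
     (\<forall>x\<in>mcarr M. msmul M 1 x = x)"

fun msum :: "'a rmod \<Rightarrow> 'a list \<Rightarrow> 'a" where
  "msum M [] = mzero M"
| "msum M (x # xs) = madd M x (msum M xs)"

definition lincomb :: "'a rmod \<Rightarrow> rat list \<Rightarrow> 'a list \<Rightarrow> 'a" where
  "lincomb M cs xs = msum M (map2 (msmul M) cs xs)"

definition span :: "rat set \<Rightarrow> 'a rmod \<Rightarrow> 'a set \<Rightarrow> 'a set" where
  "span R M S = {lincomb M cs xs | cs xs.
      set xs \<subseteq> S \<and> length cs = length xs \<and> set cs \<subseteq> R}"

definition indep :: "rat set \<Rightarrow> 'a rmod \<Rightarrow> 'a set \<Rightarrow> bool" where
  "indep R M S \<longleftrightarrow> S \<subseteq> mcarr M \<and>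
     (\<forall>xs cs. distinct xs \<and> set xs \<subseteq> S \<and> length cs = length xs \<and> set cs \<subseteq> R \<and>
        lincomb M cs xs = mzero M \<longrightarrow> (\<forall>c\<in>set cs. c = 0))"

definition free :: "rat set \<Rightarrow> 'a rmod \<Rightarrow> bool" where
  "free R M \<longleftrightarrow> (\<exists>S. indep R M S \<and> span R M S = mcarr M)"

definition torsion_free :: "rat set \<Rightarrow> 'a rmod \<Rightarrow> bool" where
  "torsion_free R M \<longleftrightarrow>
     (\<forall>r\<in>R. \<forall>x\<in>mcarr M. msmul M r x = mzero M \<longrightarrow> r = 0 \<or> x = mzero M)"

definition rank_le :: "rat set \<Rightarrow> 'a rmod \<Rightarrow> nat \<Rightarrow> bool" where
  "rank_le R M n \<longleftrightarrow> (\<forall>S. indep R M S \<longrightarrow> finite S \<and> card S \<le> n)"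

definition has_rank :: "rat set \<Rightarrow> 'a rmod \<Rightarrow> 'b rel \<Rightarrow> bool" where
  "has_rank R M k \<longleftrightarrow> (\<exists>S. indep R M S \<and> (card_of S, k) \<in> ordIso) \<and>
                        (\<forall>S. indep R M S \<longrightarrow> (card_of S, k) \<in> ordLeq)"

definition submodule :: "rat set \<Rightarrow> 'a rmod \<Rightarrow> 'a set \<Rightarrow> bool" where
  "submodule R M N \<longleftrightarrow> N \<subseteq> mcarr M \<and> mzero M \<in> N \<and>
     (\<forall>x\<in>N. \<forall>y\<in>N. madd M x y \<in> N) \<and> (\<forall>r\<in>R. \<forall>x\<in>N. msmul M r x \<in> N)"

definition submod :: "'a rmod \<Rightarrow> 'a set \<Rightarrow> 'a rmod" where
  "submod M N = M\<lparr>mcarr := N\<rparr>"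

definition rlinear :: "rat set \<Rightarrow> 'a rmod \<Rightarrow> 'b rmod \<Rightarrow> ('a \<Rightarrow> 'b) \<Rightarrow> bool" where
  "rlinear R M M' f \<longleftrightarrow> f ` mcarr M \<subseteq> mcarr M' \<and>
     (\<forall>x\<in>mcarr M. \<forall>y\<in>mcarr M. f (madd M x y) = madd M' (f x) (f y)) \<and>
     (\<forall>r\<in>R. \<forall>x\<in>mcarr M. f (msmul M r x) = msmul M' r (f x))"

definition iso :: "rat set \<Rightarrow> 'a rmod \<Rightarrow> 'b rmod \<Rightarrow> bool" where
  "iso R M M' \<longleftrightarrow> (\<exists>f. rlinear R M M' f \<and> bij_betw f (mcarr M) (mcarr M'))"

definition coset :: "'a rmod \<Rightarrow> 'a set \<Rightarrow> 'a \<Rightarrow> 'a set" where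
  "coset M N x = {madd M x n | n. n \<in> N}"

definition quot :: "'a rmod \<Rightarrow> 'a set \<Rightarrow> 'a set rmod" where
  "quot M N = \<lparr> mcarr = coset M N ` mcarr M,
      madd = (\<lambda>X Y. coset M N (madd M (SOME x. x \<in> X) (SOME y. y \<in> Y))),
      mzero = coset M N (mzero M),
      msmul = (\<lambda>r X. coset M N (msmul M r (SOME x. x \<in> X))) \<rparr>"

text \<open>B: free R-module on x_i (i < n), encoded as Inl i, and y_m, encoded as Inr m;
  elements are finitely supported R-valued coefficient functions.\<close>
definition Bmod :: "rat set \<Rightarrow> enat \<Rightarrow> (nat + nat \<Rightarrow> rat) rmod" where
  "Bmod R n = \<lparr> mcarr = {f. finite {v. f v \<noteq> 0} \<and> range f \<subseteq> R \<and>
                              (\<forall>i. \<not> enat i < n \<longrightarrow> f (Inl i) = 0)},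
      madd = (\<lambda>f g v. f v + g v),
      mzero = (\<lambda>v. 0),
      msmul = (\<lambda>r f v. r * f v) \<rparr>"

definition Ngen :: "enat \<Rightarrow> (nat \<Rightarrow> rat) \<Rightarrow> (nat \<Rightarrow> nat \<Rightarrow> rat) \<Rightarrow> nat \<Rightarrow> (nat + nat \<Rightarrow> rat)" where
  "Ngen n p k m = (\<lambda>v. case v of
       Inl i \<Rightarrow> (if enat i < n then - k i m else 0)
     | Inr j \<Rightarrow> (if j = Suc m then p m else 0) - (if j = m then 1 else 0))"

definition Nsub :: "rat set \<Rightarrow> enat \<Rightarrow> (nat \<Rightarrow> rat) \<Rightarrow> (nat \<Rightarrow> nat \<Rightarrow> rat) \<Rightarrow> (nat + nat \<Rightarrow> rat) set" where
  "Nsub R n p k = span R (Bmod R n) (range (Ngen n p k))"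

definition pres_mod :: "rat set \<Rightarrow> enat \<Rightarrow> (nat \<Rightarrow> rat) \<Rightarrow> (nat \<Rightarrow> nat \<Rightarrow> rat) \<Rightarrow> (nat + nat \<Rightarrow> rat) set rmod" where
  "pres_mod R n p k = quot (Bmod R n) (Nsub R n p k)"

definition valid_data :: "rat set \<Rightarrow> enat \<Rightarrow> (nat \<Rightarrow> rat) \<Rightarrow> (nat \<Rightarrow> nat \<Rightarrow> rat) \<Rightarrow> bool" where
  "valid_data R n p k \<longleftrightarrow> (\<forall>m. p m \<in> R \<and> p m \<noteq> 0) \<and> (\<forall>i m. enat i < n \<longrightarrow> k i m \<in> R) \<and>
     (\<forall>m. finite {i. enat i < n \<and> k i m \<noteq> 0})"

definition n_free_by_1 :: "rat set \<Rightarrow> enat \<Rightarrow> (nat \<Rightarrow> rat) \<Rightarrow> (nat \<Rightarrow> nat \<Rightarrow> rat) \<Rightarrow> bool" where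
  "n_free_by_1 R n p k \<longleftrightarrow> valid_data R n p k \<and> \<not> free R (pres_mod R n p k) \<and>
     (n \<noteq> \<infinity> \<longrightarrow> (\<forall>S. submodule R (pres_mod R n p k) S \<and>
                      rank_le R (submod (pres_mod R n p k) S) (the_enat n)
                      \<longrightarrow> free R (submod (pres_mod R n p k) S)))"

text \<open>A finite-rank-free-by-1 module is given by presentation data (n, p, k) with n finite.\<close>
type_synonym pdata = "nat \<times> (nat \<Rightarrow> rat) \<times> (nat \<Rightarrow> nat \<Rightarrow> rat)"

fun fin_free_by_1 :: "rat set \<Rightarrow> pdata \<Rightarrow> bool" where
  "fin_free_by_1 R (n, p, k) = n_free_by_1 R (enat n) p k"

fun pmod :: "rat set \<Rightarrow> pdata \<Rightarrow> (nat + nat \<Rightarrow> rat) set rmod" where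
  "pmod R (n, p, k) = pres_mod R (enat n) p k"

text \<open>Ext(B/N, L) = 0, computed from the free resolution 0 -> N -> B -> B/N -> 0:
  Ext(B/N,L) = Hom(N,L) / image of restriction Hom(B,L) -> Hom(N,L).
  It vanishes iff every homomorphism N -> L extends to B.\<close>
fun ext_zero :: "rat set \<Rightarrow> pdata \<Rightarrow> 'a rmod \<Rightarrow> bool" where
  "ext_zero R (n, p, k) L \<longleftrightarrow>
     (\<forall>\<phi>. rlinear R (submod (Bmod R (enat n)) (Nsub R (enat n) p k)) L \<phi> \<longrightarrow>
        (\<exists>f. rlinear R (Bmod R (enat n)) L f \<and> (\<forall>x\<in>Nsub R (enat n) p k. f x = \<phi> x)))"

definition Phi_complete :: "rat set \<Rightarrow> pdata set \<Rightarrow> 'a rmod \<Rightarrow> bool" where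
  "Phi_complete R \<Phi> L \<longleftrightarrow> (\<forall>d\<in>\<Phi>. ext_zero R d L)"

text \<open>Ordinal-indexed chains: indexed by the field of a well-order W (the ordinal lambda).\<close>
definition wlt :: "'i rel \<Rightarrow> 'i \<Rightarrow> 'i \<Rightarrow> bool" where
  "wlt W a b \<longleftrightarrow> (a, b) \<in> W \<and> a \<noteq> b"

definition wmin :: "'i rel \<Rightarrow> 'i \<Rightarrow> bool" where
  "wmin W a \<longleftrightarrow> a \<in> Field W \<and> (\<forall>b\<in>Field W. (a, b) \<in> W)"

definition wsucc :: "'i rel \<Rightarrow> 'i \<Rightarrow> 'i \<Rightarrow> bool" where
  "wsucc W b a \<longleftrightarrow> wlt W b a \<and> \<not> (\<exists>c. wlt W b c \<and> wlt W c a)"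

definition wlimit :: "'i rel \<Rightarrow> 'i \<Rightarrow> bool" where
  "wlimit W a \<longleftrightarrow> a \<in> Field W \<and> \<not> wmin W a \<and> \<not> (\<exists>b. wsucc W b a)"

text \<open>The chain is indexed by a well-order on a subset of the element type of G
  (this type has cardinality at least |G|, so every needed ordinal length occurs).\<close>
definition Phi_represented :: "rat set \<Rightarrow> pdata set \<Rightarrow> 'a rmod \<Rightarrow> bool" where
  "Phi_represented R \<Phi> G \<longleftrightarrow>
     (\<exists>(W :: 'a rel) C. Well_order W \<and>
        (\<forall>a\<in>Field W. submodule R G (C a)) \<and>
        (\<forall>a b. (a, b) \<in> W \<longrightarrow> C a \<subseteq> C b) \<and>
        (\<Union>a\<in>Field W. C a) = mcarr G \<and>
        (\<forall>a. wmin W a \<longrightarrow> C a = {mzero G}) \<and>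
        (\<forall>a. wlimit W a \<longrightarrow> C a = (\<Union>b\<in>{b. wlt W b a}. C b)) \<and>
        (\<forall>a b. wsucc W b a \<longrightarrow>
            (free R (quot (submod G (C a)) (C b)) \<or>
             (\<exists>d\<in>\<Phi>. iso R (quot (submod G (C a)) (C b)) (pmod R d)))))"

end

theory Submission
  imports Defs "HOL-Library.Function_Algebras" "HOL-Library.Countable_Set"
begin

text \<open>The module \<open>G\<close> is built inside the \<open>\<rat>\<close>-space of finitely supported functions on \<open>\<kappa>\<close>, which
  makes torsion-freeness automatic. A homomorphism \<open>\<psi> : N \<rightarrow> G\<close> is extended to \<open>B\<close> by sending the
  \<open>x\<^sub>i\<close> and \<open>y\<^sub>0\<close> to fresh basis vectors; the relators then determine the images of all \<open>y\<^sub>m\<close> over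
  \<open>\<rat>\<close>, and adjoining these images adds a factor \<open>B/N\<close> to the chain. Since \<open>\<kappa>\<close> is regular,
  uncountable and satisfies \<open>\<kappa>\<^sup>\<omega> = \<kappa>\<close>, an enumeration of all pairs of a presentation and a sequence of
  vectors with fibres of size \<open>\<kappa>\<close> meets every such homomorphism after all its values have been
  constructed.

  The members of the chain are pure in \<open>G\<close>, so a submodule of finite rank meets a limit
  stage as it meets some earlier stage; at successor steps it grows by a submodule of some \<open>B/N\<close> of
  rank at most \<open>n\<close>, which is free. Its freeness follows by transfinite induction.\<close>

section \<open>Modules, independence and extensions\<close>

text \<open>Abstractly, a step is the pushout of \<open>B\<close> and \<open>C \<alpha>\<close> over
  \<open>N\<close>. Forming it inside one rational vector space makes all stages subsets of one
  type, so limits are plain unions; the price is that the concrete map from \<open>B\<close> might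
  identify more than the pushout does. The fresh coordinates exclude this: modulo \<open>N\<close>,
  an element of \<open>B\<close> is a combination of the \<open>x_i\<close> and a single
  \<open>y_M\<close>, and the image of \<open>y_M\<close> has entry
  \<open>1 / (p 0 * ... * p (M - 1))\<close> at the coordinate reserved for \<open>y_0\<close>, so
  the reserved coordinates recover all coefficients. They also give purity, since for
  \<open>r \<noteq> 0\<close> they vanish on a multiple by \<open>r\<close> exactly if they vanish
  on the vector itself.

  A homomorphism on \<open>N\<close> is determined by its values on countably many relators, each
  finitely supported, so it can be coded by a countable sequence of indices; hence the cardinal
  arithmetic.

  For the freeness claim, \<open>B/N\<close> has rank at most one more than the number of the
  \<open>x_i\<close>. If its rank exceeds n, there are at least n of the \<open>x_i\<close>, and
  being free-by-1 makes its submodules of rank at most n free.\<close>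

lemma subring_Q_closed:
  assumes "subring_Q R"
  shows subring_Q_0: "0 \<in> R" and subring_Q_1: "1 \<in> R"
    and subring_Q_add: "a \<in> R \<Longrightarrow> b \<in> R \<Longrightarrow> a + b \<in> R"
    and subring_Q_mult: "a \<in> R \<Longrightarrow> b \<in> R \<Longrightarrow> a * b \<in> R"
    and subring_Q_uminus: "a \<in> R \<Longrightarrow> - a \<in> R"
proof -
  show 1: "1 \<in> R" using assms by (simp add: subring_Q_def)
  have d: "a - b \<in> R" if "a \<in> R" "b \<in> R" for a b
    using assms that by (simp add: subring_Q_def)
  show 0: "0 \<in> R" using d[OF 1 1] by simp
  show "- a \<in> R" if "a \<in> R" for a using d[OF 0 that] by simp
  show "a + b \<in> R" "a * b \<in> R" if "a \<in> R" "b \<in> R" for a b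
    using assms that by (simp_all add: subring_Q_def)
qed

lemma subring_Q_of_int: "subring_Q R \<Longrightarrow> of_int z \<in> R"
proof (induction z rule: int_induct[where k = 0])
  case (step2 i)
  then show ?case using subring_Q_add[OF step2(3), of "of_int i" "-1"]
    by (simp add: subring_Q_1 subring_Q_uminus)
qed (simp_all add: subring_Q_0 subring_Q_1 subring_Q_add)

lemma lincomb_Nil [simp]: "lincomb M [] xs = mzero M" "lincomb M cs [] = mzero M"
  by (simp_all add: lincomb_def)

lemma lincomb_Cons [simp]:
  "lincomb M (c # cs) (x # xs) = madd M (msmul M c x) (lincomb M cs xs)"
  by (simp add: lincomb_def)

lemma submod_simps [simp]:
  "mcarr (submod M K) = K" "madd (submod M K) = madd M"
  "mzero (submod M K) = mzero M" "msmul (submod M K) = msmul M"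
  "submod (submod M K) K' = submod M K'" "submod M (mcarr M) = M"
  by (simp_all add: submod_def)

lemma lincomb_submod [simp]: "lincomb (submod M K) cs xs = lincomb M cs xs"
  by (induction cs xs rule: list_induct2') simp_all

lemma span_submod [simp]: "span R (submod M K) S = span R M S"
  by (simp add: span_def)

lemma indep_submod: "indep R (submod M K) S \<Longrightarrow> K \<subseteq> mcarr M \<Longrightarrow> indep R M S"
  by (auto simp: indep_def)

text \<open>On distinct lists, coefficients may be indexed by the elements instead of by positions.
  This form survives filtering a list and turning it into a sum over a set.\<close>

lemma indep_iff_fun:
  "indep R M S \<longleftrightarrow> S \<subseteq> mcarr M \<and>
    (\<forall>xs c. distinct xs \<longrightarrow> set xs \<subseteq> S \<longrightarrow> c ` set xs \<subseteq> R \<longrightarrow>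
      lincomb M (map c xs) xs = mzero M \<longrightarrow> (\<forall>x\<in>set xs. c x = 0))" (is "_ \<longleftrightarrow> _ \<and> ?R")
proof (intro iffI conjI)
  assume S: "indep R M S"
  then show "S \<subseteq> mcarr M" by (simp add: indep_def)
  show ?R
  proof (intro allI impI)
    fix xs c assume "distinct xs" "set xs \<subseteq> S" "c ` set xs \<subseteq> R" "lincomb M (map c xs) xs = mzero M"
    then have "\<forall>a\<in>set (map c xs). a = 0"
      using S unfolding indep_def by (metis length_map set_map)
    then show "\<forall>x\<in>set xs. c x = 0" by auto
  qed
next
  assume SR: "S \<subseteq> mcarr M \<and> ?R"
  show "indep R M S" unfolding indep_def
  proof (intro conjI allI impI)
    fix xs cs
    assume "distinct xs \<and> set xs \<subseteq> S \<and> length cs = length xs \<and> set cs \<subseteq> R \<and> lincomb M cs xs = mzero M"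
    then have xs: "distinct xs" "set xs \<subseteq> S" "length cs = length xs"
      "set cs \<subseteq> R" "lincomb M cs xs = mzero M" by auto
    define c where "c = (\<lambda>x. the (map_of (zip xs cs) x))"
    have cs: "map c xs = cs"
      using xs by (intro nth_equalityI) (simp_all add: c_def map_of_zip_nth)
    have "c ` set xs \<subseteq> R" using xs(4) cs by auto
    then have "\<forall>x\<in>set xs. c x = 0" using SR xs cs by simp
    then show "\<forall>c\<in>set cs. c = 0" using cs by auto
  qed (use SR in simp)
qed

locale rat_module =
  fixes R :: "rat set" and M :: "'a rmod"
  assumes sub: "subring_Q R" and mod: "rmodule R M"
begin

lemma zero_in [simp, intro]: "mzero M \<in> mcarr M"
  and add_in [simp, intro]: "x \<in> mcarr M \<Longrightarrow> y \<in> mcarr M \<Longrightarrow> madd M x y \<in> mcarr M"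
  and smul_in [simp, intro]: "r \<in> R \<Longrightarrow> x \<in> mcarr M \<Longrightarrow> msmul M r x \<in> mcarr M"
  and smul_add: "r \<in> R \<Longrightarrow> x \<in> mcarr M \<Longrightarrow> y \<in> mcarr M
    \<Longrightarrow> msmul M r (madd M x y) = madd M (msmul M r x) (msmul M r y)"
  and add_smul: "r \<in> R \<Longrightarrow> s \<in> R \<Longrightarrow> x \<in> mcarr M
    \<Longrightarrow> msmul M (r + s) x = madd M (msmul M r x) (msmul M s x)"
  and mult_smul: "r \<in> R \<Longrightarrow> s \<in> R \<Longrightarrow> x \<in> mcarr M
    \<Longrightarrow> msmul M (r * s) x = msmul M r (msmul M s x)"
  and one_smul [simp]: "x \<in> mcarr M \<Longrightarrow> msmul M 1 x = x"
  using mod by (simp_all add: rmodule_def)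

lemma add_assoc: "x \<in> mcarr M \<Longrightarrow> y \<in> mcarr M \<Longrightarrow> z \<in> mcarr M
    \<Longrightarrow> madd M (madd M x y) z = madd M x (madd M y z)"
  using mod unfolding rmodule_def by blast

lemma add_commute: "x \<in> mcarr M \<Longrightarrow> y \<in> mcarr M \<Longrightarrow> madd M x y = madd M y x"
  using mod unfolding rmodule_def by blast

lemma zero_add [simp]: "x \<in> mcarr M \<Longrightarrow> madd M (mzero M) x = x"
  using mod unfolding rmodule_def by blast

lemma ex_neg: "x \<in> mcarr M \<Longrightarrow> \<exists>y\<in>mcarr M. madd M x y = mzero M"
  using mod unfolding rmodule_def by blast

lemma add_zero [simp]: "x \<in> mcarr M \<Longrightarrow> madd M x (mzero M) = x"
  by (simp add: add_commute[of x])

lemma add_left_commute: "x \<in> mcarr M \<Longrightarrow> y \<in> mcarr M \<Longrightarrow> z \<in> mcarr M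
    \<Longrightarrow> madd M x (madd M y z) = madd M y (madd M x z)"
  by (metis add_assoc add_commute)

lemma add_left_cancel:
  assumes "x \<in> mcarr M" "y \<in> mcarr M" "z \<in> mcarr M" "madd M x y = madd M x z"
  shows "y = z"
proof -
  obtain x' where x': "x' \<in> mcarr M" "madd M x x' = mzero M" using ex_neg assms by blast
  have "madd M (madd M x' x) y = madd M (madd M x' x) z" using assms x' by (simp add: add_assoc)
  then show ?thesis using assms x' by (simp add: add_commute[of x'])
qed

lemma zero_smul [simp]: assumes "x \<in> mcarr M" shows "msmul M 0 x = mzero M"
proof -
  have 0: "0 \<in> R" using sub by (rule subring_Q_0)
  have "madd M (msmul M 0 x) (msmul M 0 x) = madd M (msmul M 0 x) (mzero M)"
    using add_smul[OF 0 0 assms] 0 assms by simp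
  then show ?thesis using add_left_cancel 0 assms by blast
qed

lemma smul_zero [simp]: assumes "r \<in> R" shows "msmul M r (mzero M) = mzero M"
proof -
  have "madd M (msmul M r (mzero M)) (msmul M r (mzero M)) = madd M (msmul M r (mzero M)) (mzero M)"
    using smul_add[OF assms zero_in zero_in] assms by simp
  then show ?thesis using add_left_cancel assms by blast
qed

lemma neg_in [simp, intro]: "x \<in> mcarr M \<Longrightarrow> msmul M (-1) x \<in> mcarr M"
  using sub by (simp add: subring_Q_1 subring_Q_uminus)

lemma add_neg [simp]: "x \<in> mcarr M \<Longrightarrow> madd M x (msmul M (-1) x) = mzero M"
  using add_smul[of 1 "-1" x] sub by (simp add: subring_Q_1 subring_Q_uminus)

lemma neg_add_cancel:
  "x \<in> mcarr M \<Longrightarrow> y \<in> mcarr M \<Longrightarrow> madd M x (madd M (msmul M (-1) x) y) = y"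
  by (simp flip: add_assoc)

lemma lincomb_in:
  "set xs \<subseteq> mcarr M \<Longrightarrow> set cs \<subseteq> R \<Longrightarrow> lincomb M cs xs \<in> mcarr M"
  by (induction cs xs rule: list_induct2') simp_all

lemma lincomb_append:
  "length cs = length xs \<Longrightarrow> set (xs @ ys) \<subseteq> mcarr M \<Longrightarrow> set (cs @ ds) \<subseteq> R \<Longrightarrow>
    lincomb M (cs @ ds) (xs @ ys) = madd M (lincomb M cs xs) (lincomb M ds ys)"
  by (induction cs xs rule: list_induct2) (simp_all add: lincomb_in add_assoc)

lemma smul_lincomb:
  "r \<in> R \<Longrightarrow> set xs \<subseteq> mcarr M \<Longrightarrow> set cs \<subseteq> R \<Longrightarrow>
    msmul M r (lincomb M cs xs) = lincomb M (map ((*) r) cs) xs"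
  by (induction cs xs rule: list_induct2') (simp_all add: lincomb_in smul_add mult_smul)

text \<open>With \<open>g\<close> the identity this drops terms inside a module, with
  \<open>g\<close> a homomorphism it drops the terms that the homomorphism kills.\<close>

lemma lincomb_filter:
  assumes "g ` set xs \<subseteq> mcarr M" "c ` set xs \<subseteq> R"
    and "\<And>x. x \<in> set xs \<Longrightarrow> \<not> P x \<Longrightarrow> msmul M (c x) (g x) = mzero M"
  shows "lincomb M (map c xs) (map g xs) = lincomb M (map c (filter P xs)) (map g (filter P xs))"
  using assms
proof (induction xs)
  case (Cons x xs)
  have "lincomb M (map c (filter P xs)) (map g (filter P xs)) \<in> mcarr M"
    using Cons.prems by (intro lincomb_in) auto
  with Cons show ?case by simp
qed simp

lemma submodule_span: assumes "S \<subseteq> mcarr M" shows "submodule R M (span R M S)"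
  unfolding submodule_def
proof (intro conjI ballI)
  show "span R M S \<subseteq> mcarr M" using assms by (auto simp: span_def intro!: lincomb_in)
  show "mzero M \<in> span R M S" unfolding span_def by (force intro: exI[of _ "[]"])
next
  fix x y assume "x \<in> span R M S" "y \<in> span R M S"
  then obtain cs xs ds ys where "x = lincomb M cs xs" "y = lincomb M ds ys"
    and *: "set xs \<subseteq> S" "length cs = length xs" "set cs \<subseteq> R"
      "set ys \<subseteq> S" "length ds = length ys" "set ds \<subseteq> R"
    by (auto simp: span_def)
  then have "madd M x y = lincomb M (cs @ ds) (xs @ ys)" using assms by (subst lincomb_append) auto
  then show "madd M x y \<in> span R M S" unfolding span_def using *
    by (intro CollectI exI[of _ "cs @ ds"] exI[of _ "xs @ ys"]) auto
next
  fix r x assume "r \<in> R" "x \<in> span R M S"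
  then obtain cs xs where "x = lincomb M cs xs"
    and *: "set xs \<subseteq> S" "length cs = length xs" "set cs \<subseteq> R"
    by (auto simp: span_def)
  then have "msmul M r x = lincomb M (map ((*) r) cs) xs"
    using assms \<open>r \<in> R\<close> by (subst smul_lincomb[symmetric]) auto
  then show "msmul M r x \<in> span R M S" unfolding span_def using * \<open>r \<in> R\<close> sub
    by (intro CollectI exI[of _ "map ((*) r) cs"] exI[of _ xs]) (auto intro: subring_Q_mult)
qed

lemma span_superset: "S \<subseteq> mcarr M \<Longrightarrow> S \<subseteq> span R M S"
proof
  fix x assume "S \<subseteq> mcarr M" "x \<in> S"
  then have "x = lincomb M [1] [x]" by auto
  then show "x \<in> span R M S" unfolding span_def using \<open>x \<in> S\<close> sub
    by (intro CollectI exI[of _ "[1]"] exI[of _ "[x]"]) (simp add: subring_Q_1)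
qed

lemma rmodule_submod: assumes "submodule R M K" shows "rat_module R (submod M K)"
proof
  have K: "K \<subseteq> mcarr M" "mzero M \<in> K" "\<And>x y. x \<in> K \<Longrightarrow> y \<in> K \<Longrightarrow> madd M x y \<in> K"
    "\<And>r x. r \<in> R \<Longrightarrow> x \<in> K \<Longrightarrow> msmul M r x \<in> K"
    using assms by (auto simp: submodule_def)
  have "\<exists>y\<in>K. madd M x y = mzero M" if "x \<in> K" for x
  proof
    show "msmul M (-1) x \<in> K" using K that sub by (simp add: subring_Q_1 subring_Q_uminus)
    show "madd M x (msmul M (-1) x) = mzero M" using K that by auto
  qed
  note neg = this
  have *: "\<And>x. x \<in> K \<Longrightarrow> x \<in> mcarr M" using K(1) by auto
  show "rmodule R (submod M K)" unfolding rmodule_def submod_simps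
    by (intro conjI ballI; (rule K neg add_assoc add_commute smul_add add_smul mult_smul
      zero_add one_smul; (assumption | rule *)+))
qed (rule sub)

end

section \<open>Homomorphisms, images and extensions by free modules\<close>

lemma rlinear_zero:
  assumes "rat_module R M" "rat_module R Q" "rlinear R M Q f"
  shows "f (mzero M) = mzero Q"
proof -
  interpret M: rat_module R M by fact
  interpret Q: rat_module R Q by fact
  have "0 \<in> R" using M.sub by (rule subring_Q_0)
  then have "f (msmul M 0 (mzero M)) = msmul Q 0 (f (mzero M))"
    using assms(3) M.zero_in unfolding rlinear_def by blast
  moreover have "f (mzero M) \<in> mcarr Q" using assms(3) M.zero_in unfolding rlinear_def by blast
  ultimately show ?thesis by simp
qed

lemma rlinear_lincomb:
  assumes "rat_module R M" "rat_module R Q" "rlinear R M Q f"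
    and "set xs \<subseteq> mcarr M" "set cs \<subseteq> R"
  shows "f (lincomb M cs xs) = lincomb Q cs (map f xs)"
  using assms(4,5)
proof (induction cs xs rule: list_induct2')
  case (4 c cs x xs)
  interpret M: rat_module R M by fact
  have "f (madd M (msmul M c x) (lincomb M cs xs)) = madd Q (msmul Q c (f x)) (f (lincomb M cs xs))"
    using assms(3) 4 M.lincomb_in[of xs cs] by (simp add: rlinear_def)
  with 4 show ?case by simp
qed (simp_all add: rlinear_zero[OF assms(1-3)])

lemma submodule_image:
  assumes "rat_module R M" "rat_module R Q" "rlinear R M Q f"
  shows "submodule R Q (f ` mcarr M)"
proof -
  interpret M: rat_module R M by fact
  have 1: "f ` mcarr M \<subseteq> mcarr Q"
    and 2: "\<And>x y. x \<in> mcarr M \<Longrightarrow> y \<in> mcarr M \<Longrightarrow> madd Q (f x) (f y) = f (madd M x y)"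
    and 3: "\<And>r x. r \<in> R \<Longrightarrow> x \<in> mcarr M \<Longrightarrow> msmul Q r (f x) = f (msmul M r x)"
    using assms(3) by (auto simp: rlinear_def)
  show ?thesis unfolding submodule_def
  proof (intro conjI ballI)
    show "mzero Q \<in> f ` mcarr M" using rlinear_zero[OF assms] M.zero_in by (metis imageI)
  qed (use 1 in blast, auto simp: 2 3)
qed

text \<open>An independent subset of the image lifts along a section of \<open>f\<close> to an
  independent subset of \<open>M\<close>: applying \<open>f\<close> to a relation between the lifts
  gives a relation between the original elements.\<close>

lemma rank_le_image:
  assumes "rat_module R M" "rat_module R Q" "rlinear R M Q f" "rank_le R M n"
  shows "rank_le R (submod Q (f ` mcarr M)) n"
  unfolding rank_le_def
proof (intro allI impI)
  fix S assume S: "indep R (submod Q (f ` mcarr M)) S"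
  define g where "g = inv_into (mcarr M) f"
  have SM: "S \<subseteq> f ` mcarr M" using S by (simp add: indep_def)
  have g: "g y \<in> mcarr M" "f (g y) = y" if "y \<in> S" for y
    using SM that by (auto simp: g_def inv_into_into f_inv_into_f)
  have inj: "inj_on g S" by (metis g(2) inj_onI)
  have "indep R M (g ` S)" unfolding indep_def
  proof (intro conjI allI impI)
    fix xs cs
    assume *: "distinct xs \<and> set xs \<subseteq> g ` S \<and> length cs = length xs \<and> set cs \<subseteq> R \<and>
      lincomb M cs xs = mzero M"
    have "inj_on f (g ` S)" by (rule inj_onI) (auto simp: g)
    then have "distinct (map f xs)" using * by (auto simp: distinct_map inj_on_subset)
    moreover have "set (map f xs) \<subseteq> S" using * g by auto
    moreover have "set xs \<subseteq> mcarr M" using * g by auto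
    then have "lincomb Q cs (map f xs) = mzero Q"
      using rlinear_lincomb[OF assms(1-3), of xs cs] rlinear_zero[OF assms(1-3)] * by simp
    ultimately show "\<forall>c\<in>set cs. c = 0"
      using S * unfolding indep_def by (metis length_map lincomb_submod submod_simps(3))
  qed (use g in auto)
  then have "finite (g ` S) \<and> card (g ` S) \<le> n" using assms(4) by (simp add: rank_le_def)
  then show "finite S \<and> card S \<le> n" using inj by (simp add: card_image finite_image_iff)
qed

lemma free_extension:
  assumes M: "rat_module R M" and Q: "rat_module R Q" and f: "rlinear R M Q f"
    and K: "K = {x \<in> mcarr M. f x = mzero Q}" "free R (submod M K)"
    and im: "free R (submod Q (f ` mcarr M))"
  shows "free R M"
proof -
  interpret M: rat_module R M by fact
  interpret Q: rat_module R Q by fact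
  obtain S where S: "indep R (submod M K) S" "span R M S = K" using K(2) by (auto simp: free_def)
  obtain T where T: "indep R (submod Q (f ` mcarr M)) T" "span R Q T = f ` mcarr M"
    using im by (auto simp: free_def)
  have SK: "S \<subseteq> K" and TQ: "T \<subseteq> f ` mcarr M" using S T by (simp_all add: indep_def)
  have fQ: "f x \<in> mcarr Q" if "x \<in> mcarr M" for x using f that by (auto simp: rlinear_def)
  define g where "g = inv_into (mcarr M) f"
  have g: "g y \<in> mcarr M" "f (g y) = y" if "y \<in> T" for y
    using TQ that by (auto simp: g_def inv_into_into f_inv_into_f)
  have SgT: "S \<union> g ` T \<subseteq> mcarr M" using SK K(1) g by auto
  have injf: "inj_on f (g ` T)" by (rule inj_onI) (auto simp: g)
  have "indep R M (S \<union> g ` T)" unfolding indep_iff_fun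
  proof (intro conjI allI impI)
    fix xs c
    assume xs: "distinct xs" "set xs \<subseteq> S \<union> g ` T" "c ` set xs \<subseteq> R"
      "lincomb M (map c xs) xs = mzero M"
    have xsM: "set xs \<subseteq> mcarr M" using xs(2) SgT by (rule subset_trans)
    define ys where "ys = filter (\<lambda>x. x \<notin> S) xs"
    \<comment> \<open>\<open>f\<close> kills the terms from \<open>S\<close>, so a relation in
      \<open>T\<close> remains and forces the coefficients outside \<open>S\<close> to vanish. After
      that the original relation is one in \<open>S\<close> alone.\<close>
    have "mzero Q = lincomb Q (map c xs) (map f xs)"
      using rlinear_lincomb[OF M Q f xsM, of "map c xs"] xs rlinear_zero[OF M Q f] by simp
    also have "\<dots> = lincomb Q (map c ys) (map f ys)" unfolding ys_def
    proof (intro Q.lincomb_filter)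
      show "msmul Q (c x) (f x) = mzero Q" if "x \<in> set xs" "\<not> x \<notin> S" for x
        using that xs(3) SK K(1) by (auto simp: image_subset_iff)
    qed (use xs xsM fQ in auto)
    finally have "lincomb Q (map c ys) (map f ys) = mzero Q" by simp
    moreover have "distinct (map f ys)" "set (map f ys) \<subseteq> T" "set (map c ys) \<subseteq> R"
      using xs injf g by (auto simp: ys_def distinct_map intro: inj_on_subset)
    ultimately have "\<forall>a\<in>set (map c ys). a = 0"
      using T(1) unfolding indep_def by (metis length_map lincomb_submod submod_simps(3))
    then have ys0: "c x = 0" if "x \<in> set xs" "x \<notin> S" for x using that by (auto simp: ys_def)
    define zs where "zs = filter (\<lambda>x. x \<in> S) xs"
    have "mzero M = lincomb M (map c xs) (map (\<lambda>x. x) xs)" using xs by simp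
    also have "\<dots> = lincomb M (map c zs) (map (\<lambda>x. x) zs)" unfolding zs_def
      using xs xsM ys0 by (intro M.lincomb_filter) auto
    finally have "lincomb (submod M K) (map c zs) zs = mzero (submod M K)" by simp
    moreover have "distinct zs" "set zs \<subseteq> S" "c ` set zs \<subseteq> R" using xs by (auto simp: zs_def)
    ultimately have "\<forall>x\<in>set zs. c x = 0"
      using S(1) unfolding indep_iff_fun by blast
    then show "\<forall>x\<in>set xs. c x = 0" using ys0 by (auto simp: zs_def)
  qed (rule SgT)
  moreover have "mcarr M \<subseteq> span R M (S \<union> g ` T)"
  proof
    fix x assume x: "x \<in> mcarr M"
    then have "f x \<in> span R Q T" using T(2) by auto
    then obtain cs ys where ys: "f x = lincomb Q cs ys" "set ys \<subseteq> T" "length cs = length ys" "set cs \<subseteq> R"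
      by (auto simp: span_def)
    define y where "y = lincomb M cs (map g ys)"
    have gysM: "set (map g ys) \<subseteq> mcarr M" using ys g by auto
    then have yM: "y \<in> mcarr M" using ys unfolding y_def by (intro M.lincomb_in)
    have "map f (map g ys) = ys" using ys g by (auto intro!: map_idI)
    then have fy: "f y = f x"
      using rlinear_lincomb[OF M Q f gysM ys(4)] ys(1) by (simp add: y_def)
    define z where "z = madd M (msmul M (-1) y) x"
    have "f z = madd Q (msmul Q (-1) (f y)) (f x)"
      using f yM x M.sub by (simp add: z_def rlinear_def subring_Q_1 subring_Q_uminus)
    then have "f z = mzero Q" using fy fQ[OF x] by (simp add: Q.add_commute)
    then have "z \<in> span R M S" using S(2) K(1) yM x by (simp add: z_def)
    then have "z \<in> span R M (S \<union> g ` T)" unfolding span_def by blast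
    moreover have "y \<in> span R M (S \<union> g ` T)" unfolding span_def y_def using ys
      by (intro CollectI exI[of _ cs] exI[of _ "map g ys"]) auto
    moreover have "x = madd M y z" using yM x by (simp add: z_def M.neg_add_cancel)
    ultimately show "x \<in> span R M (S \<union> g ` T)"
      using M.submodule_span[OF SgT] by (simp add: submodule_def)
  qed
  then have "span R M (S \<union> g ` T) = mcarr M"
    using M.submodule_span[OF SgT] by (auto simp: submodule_def)
  ultimately show ?thesis by (auto simp: free_def)
qed

section \<open>Quotients\<close>

lemma coset_submod [simp]: "coset (submod M K') K x = coset M K x"
  by (simp add: coset_def)

lemma mcarr_quot: "mcarr (quot M K) = coset M K ` mcarr M"
  and mzero_quot: "mzero (quot M K) = coset M K (mzero M)"
  by (simp_all add: quot_def)

context rat_module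
begin

context
  fixes K assumes K: "submodule R M K"
begin

private lemma KD:
  shows "k \<in> K \<Longrightarrow> k \<in> mcarr M" "mzero M \<in> K"
    "k \<in> K \<Longrightarrow> l \<in> K \<Longrightarrow> madd M k l \<in> K" "r \<in> R \<Longrightarrow> k \<in> K \<Longrightarrow> msmul M r k \<in> K"
    "k \<in> K \<Longrightarrow> msmul M (-1) k \<in> K"
  using K sub by (auto simp: submodule_def subring_Q_1 subring_Q_uminus)

lemma coset_add_cancel:
  assumes "x \<in> mcarr M" "k \<in> K"
  shows "coset M K (madd M x k) = coset M K x"
proof
  show "coset M K (madd M x k) \<subseteq> coset M K x"
    using assms KD by (auto simp: coset_def add_assoc)
  show "coset M K x \<subseteq> coset M K (madd M x k)"
  proof
    fix z assume "z \<in> coset M K x"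
    then obtain n where n: "n \<in> K" "z = madd M x n" by (auto simp: coset_def)
    then have "z = madd M (madd M x k) (madd M (msmul M (-1) k) n)"
      using assms KD by (simp add: add_assoc neg_add_cancel)
    then show "z \<in> coset M K (madd M x k)" unfolding coset_def using n assms KD by blast
  qed
qed

text \<open>The operations of \<open>quot\<close> work on representatives picked by
  \<open>SOME\<close>. That a pick differs from \<open>x\<close> by an element of \<open>K\<close>
  is all that their computation requires.\<close>

lemma some_coset:
  assumes "x \<in> mcarr M"
  obtains k where "k \<in> K" "(SOME z. z \<in> coset M K x) = madd M x k"
proof -
  have "madd M x (mzero M) \<in> coset M K x" unfolding coset_def using KD by blast
  then have "(SOME z. z \<in> coset M K x) \<in> coset M K x" by (rule someI)
  then show ?thesis using that unfolding coset_def by blast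
qed

lemma madd_quot:
  assumes "x \<in> mcarr M" "y \<in> mcarr M"
  shows "madd (quot M K) (coset M K x) (coset M K y) = coset M K (madd M x y)"
proof -
  obtain k where k: "k \<in> K" "(SOME z. z \<in> coset M K x) = madd M x k"
    by (rule some_coset[OF assms(1)])
  obtain l where l: "l \<in> K" "(SOME z. z \<in> coset M K y) = madd M y l"
    by (rule some_coset[OF assms(2)])
  have "madd M (madd M x k) (madd M y l) = madd M (madd M x y) (madd M k l)"
    using assms KD(1)[OF k(1)] KD(1)[OF l(1)] by (simp add: add_assoc add_left_commute)
  then show ?thesis using k l assms KD by (simp add: quot_def coset_add_cancel)
qed

lemma msmul_quot:
  assumes "r \<in> R" "x \<in> mcarr M"
  shows "msmul (quot M K) r (coset M K x) = coset M K (msmul M r x)"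
proof -
  obtain k where k: "k \<in> K" "(SOME z. z \<in> coset M K x) = madd M x k"
    by (rule some_coset[OF assms(2)])
  then show ?thesis using assms KD by (simp add: quot_def coset_add_cancel smul_add)
qed

lemma coset_zero: "coset M K (mzero M) = K"
proof -
  have "madd M (mzero M) n = n" if "n \<in> K" for n using that KD(1) by simp
  then show ?thesis unfolding coset_def by force
qed

lemma coset_eq_zero_iff:
  assumes "x \<in> mcarr M"
  shows "coset M K x = mzero (quot M K) \<longleftrightarrow> x \<in> K"
proof
  assume "coset M K x = mzero (quot M K)"
  moreover have "madd M x (mzero M) \<in> coset M K x" unfolding coset_def using KD by blast
  ultimately show "x \<in> K" using assms by (simp add: mzero_quot coset_zero)
next
  assume "x \<in> K"
  then show "coset M K x = mzero (quot M K)"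
    using coset_add_cancel[OF zero_in, of x] assms by (simp add: mzero_quot)
qed

lemma rat_module_quot: "rat_module R (quot M K)"
proof
  note q = madd_quot msmul_quot mcarr_quot mzero_quot
  show "rmodule R (quot M K)" unfolding rmodule_def
  proof (intro conjI)
    show "\<forall>x\<in>mcarr (quot M K). \<exists>y\<in>mcarr (quot M K). madd (quot M K) x y = mzero (quot M K)"
    proof
      fix X assume "X \<in> mcarr (quot M K)"
      then obtain x where "x \<in> mcarr M" "X = coset M K x" by (auto simp: mcarr_quot)
      then show "\<exists>Y\<in>mcarr (quot M K). madd (quot M K) X Y = mzero (quot M K)"
        by (intro bexI[of _ "coset M K (msmul M (-1) x)"]) (simp_all add: q)
    qed
    show "\<forall>x\<in>mcarr (quot M K). \<forall>y\<in>mcarr (quot M K). madd (quot M K) x y = madd (quot M K) y x"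
      by (auto simp: q add_commute)
  qed (use sub in \<open>auto simp: q add_assoc smul_add add_smul mult_smul
        subring_Q_1 subring_Q_add subring_Q_mult\<close>)
qed (rule sub)

lemma quot_lift:
  assumes Q: "rat_module R Q" and f: "rlinear R M Q f" and ker: "\<And>x. x \<in> K \<Longrightarrow> f x = mzero Q"
  defines "h \<equiv> \<lambda>X. f (SOME x. x \<in> X)"
  shows quot_lift_coset: "x \<in> mcarr M \<Longrightarrow> h (coset M K x) = f x"
    and quot_lift_rlinear: "rlinear R (quot M K) Q h"
proof -
  interpret Q: rat_module R Q by fact
  have h: "h (coset M K x) = f x" if x: "x \<in> mcarr M" for x
  proof -
    obtain k where k: "k \<in> K" "(SOME z. z \<in> coset M K x) = madd M x k"
      by (rule some_coset[OF x])
    then have "h (coset M K x) = madd Q (f x) (mzero Q)"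
      using that f KD(1)[of k] ker[of k] by (simp add: h_def rlinear_def)
    moreover have "f x \<in> mcarr Q" using f that by (auto simp: rlinear_def)
    ultimately show ?thesis by simp
  qed
  then show "x \<in> mcarr M \<Longrightarrow> h (coset M K x) = f x" .
  show "rlinear R (quot M K) Q h"
    using f unfolding rlinear_def by (auto simp: mcarr_quot madd_quot msmul_quot h)
qed

text \<open>The zero module is free on the empty basis. This serves the steps at which the chain
  does not grow.\<close>

lemma quot_self_free: assumes "K = mcarr M" shows "free R (quot M K)"
proof -
  have "x \<in> span R (quot M K) {}" if x: "x \<in> mcarr (quot M K)" for x
  proof -
    obtain y where "y \<in> mcarr M" "x = coset M K y" using x unfolding mcarr_quot by blast
    then have "x = lincomb (quot M K) [] []" using coset_eq_zero_iff assms by simp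
    then show ?thesis by (force simp: span_def)
  qed
  moreover have "span R (quot M K) {} \<subseteq> mcarr (quot M K)"
    by (auto simp: span_def mcarr_quot mzero_quot)
  ultimately have "span R (quot M K) {} = mcarr (quot M K)" by blast
  moreover have "indep R (quot M K) {}" by (simp add: indep_def)
  ultimately show ?thesis unfolding free_def by blast
qed

end

lemma rlinear_inj_onI:
  assumes Q: "rat_module R Q" and f: "rlinear R M Q f"
    and ker: "\<And>x. x \<in> mcarr M \<Longrightarrow> f x = mzero Q \<Longrightarrow> x = mzero M"
  shows "inj_on f (mcarr M)"
proof (rule inj_onI)
  interpret Q: rat_module R Q by fact
  fix x y assume xy: "x \<in> mcarr M" "y \<in> mcarr M" "f x = f y"
  have "f (madd M y (msmul M (-1) x)) = madd Q (f y) (msmul Q (-1) (f x))"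
    using f xy sub by (simp add: rlinear_def subring_Q_1 subring_Q_uminus)
  also have "\<dots> = mzero Q" using f xy by (auto simp: rlinear_def)
  finally have "madd M y (msmul M (-1) x) = mzero M" using ker xy by simp
  then have "madd M x (mzero M) = madd M x (madd M (msmul M (-1) x) y)"
    using xy by (simp add: add_commute)
  then show "x = y" using xy by (simp add: neg_add_cancel)
qed

lemma first_isomorphism:
  assumes Q: "rat_module R Q" and f: "rlinear R M Q f" "f ` mcarr M = mcarr Q"
    and K: "K = {x \<in> mcarr M. f x = mzero Q}"
  shows "iso R (quot M K) Q"
proof -
  interpret Q: rat_module R Q by fact
  have subm: "submodule R M K" unfolding submodule_def K
    using f rlinear_zero[OF rat_module_axioms Q f(1)] by (auto simp: rlinear_def)
  note KQ = rat_module_quot[OF subm]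
  define h where "h = (\<lambda>X. f (SOME x. x \<in> X))"
  have h: "x \<in> mcarr M \<Longrightarrow> h (coset M K x) = f x" "rlinear R (quot M K) Q h" for x
    unfolding h_def using quot_lift[OF subm Q f(1)] K by auto
  have "inj_on h (mcarr (quot M K))"
  proof (rule rat_module.rlinear_inj_onI[OF KQ Q h(2)])
    fix X assume "X \<in> mcarr (quot M K)" "h X = mzero Q"
    then obtain x where "x \<in> mcarr M" "X = coset M K x" "f x = mzero Q"
      using h(1) by (auto simp: mcarr_quot)
    then show "X = mzero (quot M K)" using coset_eq_zero_iff[OF subm] K by simp
  qed
  moreover have "h ` mcarr (quot M K) = mcarr Q"
    using h(1) f(2) by (simp add: mcarr_quot image_image cong: image_cong_simp)
  ultimately show ?thesis unfolding iso_def bij_betw_def using h(2) by blast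
qed

end

lemma indep_inj_image:
  assumes M: "rat_module R M" and Q: "rat_module R Q" and f: "rlinear R M Q f" "inj_on f (mcarr M)"
    and S: "indep R M S"
  shows "indep R Q (f ` S)"
proof -
  interpret M: rat_module R M by fact
  have SM: "S \<subseteq> mcarr M" using S by (simp add: indep_def)
  show ?thesis unfolding indep_def
  proof (intro conjI allI impI)
    show "f ` S \<subseteq> mcarr Q" using SM f(1) by (auto simp: rlinear_def)
    fix ys cs
    assume *: "distinct ys \<and> set ys \<subseteq> f ` S \<and> length cs = length ys \<and> set cs \<subseteq> R \<and> lincomb Q cs ys = mzero Q"
    define xs where "xs = map (inv_into S f) ys"
    have xs: "set xs \<subseteq> S" using * by (auto simp: xs_def inv_into_into)
    have ys: "ys = map f xs" using * by (auto simp: xs_def f_inv_into_f subset_iff intro!: map_idI[symmetric])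
    have "f (lincomb M cs xs) = f (mzero M)"
      using rlinear_lincomb[OF M Q f(1), of xs cs] rlinear_zero[OF M Q f(1)] xs SM * ys by auto
    then have "lincomb M cs xs = mzero M"
      using f(2) xs SM * by (auto dest!: inj_onD intro!: M.lincomb_in)
    moreover have "distinct xs" "length cs = length xs" using * ys by (auto simp: distinct_map)
    ultimately show "\<forall>c\<in>set cs. c = 0" using S * xs unfolding indep_def by blast
  qed
qed

section \<open>Modules of rational-valued functions\<close>

definition fsc :: "rat \<Rightarrow> ('a \<Rightarrow> rat) \<Rightarrow> 'a \<Rightarrow> rat" where
  "fsc r f = (\<lambda>v. r * f v)"

text \<open>All carriers share the operations of one ambient space, so a submodule of
  \<open>fmod X\<close> is again some \<open>fmod Y\<close>, and combinations can be moved from one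
  stage to another unchanged.\<close>

definition fmod :: "('a \<Rightarrow> rat) set \<Rightarrow> ('a \<Rightarrow> rat) rmod" where
  "fmod X = \<lparr>mcarr = X, madd = (+), mzero = 0, msmul = fsc\<rparr>"

definition rsub :: "rat set \<Rightarrow> ('a \<Rightarrow> rat) set \<Rightarrow> bool" where
  "rsub R X \<longleftrightarrow> 0 \<in> X \<and> (\<forall>x\<in>X. \<forall>y\<in>X. x + y \<in> X) \<and> (\<forall>r\<in>R. \<forall>x\<in>X. fsc r x \<in> X)"

lemma fsc_apply [simp]: "fsc r f v = r * f v"
  by (simp add: fsc_def)

interpretation fv: vector_space fsc
  by unfold_locales (auto simp: fun_eq_iff algebra_simps)

lemma fmod_simps [simp]:
  "mcarr (fmod X) = X" "madd (fmod X) = (+)" "mzero (fmod X) = 0" "msmul (fmod X) = fsc"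
  "submod (fmod X) Y = fmod Y"
  by (simp_all add: fmod_def submod_def)

lemma rsubD:
  assumes "rsub R X"
  shows "0 \<in> X" "x \<in> X \<Longrightarrow> y \<in> X \<Longrightarrow> x + y \<in> X" "r \<in> R \<Longrightarrow> x \<in> X \<Longrightarrow> fsc r x \<in> X"
  using assms by (simp_all add: rsub_def)

lemma rsub_sum: "rsub R X \<Longrightarrow> (\<And>a. a \<in> A \<Longrightarrow> f a \<in> X) \<Longrightarrow> sum f A \<in> X"
  by (induction A rule: infinite_finite_induct) (simp_all add: rsubD)

lemma rsub_inter: "rsub R X \<Longrightarrow> rsub R Y \<Longrightarrow> rsub R (X \<inter> Y)"
  by (simp add: rsub_def)

lemma rat_module_fmod: assumes "subring_Q R" "rsub R X" shows "rat_module R (fmod X)"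
proof
  have "\<exists>y\<in>X. x + y = 0" if "x \<in> X" for x
    using assms that rsubD(3)[of R X "-1" x]
    by (intro bexI[of _ "fsc (-1) x"]) (auto simp: subring_Q_1 subring_Q_uminus fun_eq_iff)
  moreover have "fsc 1 x = x" for x :: "'a \<Rightarrow> rat" by (simp add: fun_eq_iff)
  ultimately show "rmodule R (fmod X)" unfolding rmodule_def using rsubD[OF assms(2)]
    by (simp add: fv.scale_right_distrib fv.scale_left_distrib add_ac)
qed (rule assms)

lemma submodule_fmod: "submodule R (fmod X) Y \<longleftrightarrow> Y \<subseteq> X \<and> rsub R Y"
  by (auto simp: submodule_def rsub_def)

lemma rsub_UNIV: "rsub R UNIV"
  by (simp add: rsub_def)

lemma lincomb_fmod_eq: "lincomb (fmod X) cs xs = lincomb (fmod Y) cs xs"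
  by (induction cs xs rule: list_induct2') simp_all

lemma lincomb_fmod_sum:
  "distinct xs \<Longrightarrow> lincomb (fmod X) (map c xs) xs = (\<Sum>x\<in>set xs. fsc (c x) x)"
  by (induction xs) simp_all

section \<open>Independence over \<open>R\<close> compared with independence over the
  rationals\<close>

lemma indep_fmod_if_independent:
  assumes "S \<subseteq> X" "fv.independent S" shows "indep R (fmod X) S"
  unfolding indep_iff_fun
proof (intro conjI allI impI)
  fix xs c
  assume "distinct xs" "set xs \<subseteq> S" "lincomb (fmod X) (map c xs) xs = mzero (fmod X)"
  then show "\<forall>x\<in>set xs. c x = 0"
    using assms(2) unfolding fv.dependent_explicit by (auto simp: lincomb_fmod_sum)
qed (use assms in simp)

lemma rat_common_denominator:
  fixes c :: "'a \<Rightarrow> rat" assumes "finite A"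
  obtains D :: int where "D \<noteq> 0" "\<And>a. a \<in> A \<Longrightarrow> of_int D * c a \<in> \<int>"
  using assms
proof (induction A arbitrary: thesis)
  case empty
  show ?case by (rule empty[of 1]) auto
next
  case (insert a A)
  obtain D :: int where D: "D \<noteq> 0" "\<And>x. x \<in> A \<Longrightarrow> of_int D * c x \<in> \<int>" using insert.IH by blast
  obtain p q where pq: "c a = of_int p / of_int q" "q > 0"
    by (metis quotient_of_div quotient_of_denom_pos surj_pair)
  show ?case
  proof (rule insert.prems)
    show "q * D \<noteq> 0" using D pq by simp
    show "of_int (q * D) * c x \<in> \<int>" if x: "x \<in> insert a A" for x
    proof (cases "x = a")
      case True
      have "of_int (q * D) * c x = of_int (D * p)" using pq True by simp
      then show ?thesis by (simp del: of_int_mult)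
    next
      case False
      then have "of_int D * c x \<in> \<int>" using D(2) x by blast
      then have "of_int q * (of_int D * c x) \<in> \<int>" by (rule Ints_mult[OF Ints_of_int])
      then show ?thesis by (simp add: mult.assoc)
    qed
  qed
qed

text \<open>A rational relation is multiplied by a common denominator of its coefficients; the new
  coefficients are integers and therefore lie in \<open>R\<close>.\<close>

lemma independent_if_indep_fmod:
  assumes R: "subring_Q R" and S: "indep R (fmod X) S"
  shows "fv.independent S"
proof
  assume "fv.dependent S"
  then obtain A c where A: "finite A" "A \<subseteq> S" "(\<Sum>x\<in>A. fsc (c x) x) = 0" "\<exists>x\<in>A. c x \<noteq> 0"
    unfolding fv.dependent_explicit by blast
  obtain D :: int where D: "D \<noteq> 0" "\<And>x. x \<in> A \<Longrightarrow> of_int D * c x \<in> \<int>"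
    using rat_common_denominator[OF A(1)] by blast
  obtain xs where xs: "set xs = A" "distinct xs" using A(1) finite_distinct_list by blast
  define c' where "c' = (\<lambda>x. of_int D * c x)"
  have "lincomb (fmod X) (map c' xs) xs = fsc (of_int D) (\<Sum>x\<in>A. fsc (c x) x)"
    using xs by (simp add: lincomb_fmod_sum c'_def fv.scale_sum_right)
  also have "\<dots> = 0" using A by simp
  finally have "lincomb (fmod X) (map c' xs) xs = mzero (fmod X)" by simp
  moreover have "c' ` set xs \<subseteq> R"
    using D(2) xs subring_Q_of_int[OF R] unfolding c'_def by (metis Ints_cases image_subsetI)
  ultimately have "\<forall>x\<in>set xs. c' x = 0" using S xs A unfolding indep_iff_fun by blast
  then show False using A(4) D(1) xs by (auto simp: c'_def)
qed

text \<open>Combined with purity, this turns inclusion in the rational span of a stage into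
  inclusion in the stage itself.\<close>

lemma span_clear_denominator:
  assumes R: "subring_Q R" and X: "rsub R X" and x: "x \<in> fv.span X"
  shows "\<exists>r\<in>R. r \<noteq> 0 \<and> fsc r x \<in> X"
proof -
  obtain A c where A: "finite A" "A \<subseteq> X" "x = (\<Sum>a\<in>A. fsc (c a) a)"
    using x unfolding fv.span_explicit by blast
  obtain D :: int where D: "D \<noteq> 0" "\<And>x. x \<in> A \<Longrightarrow> of_int D * c x \<in> \<int>"
    using rat_common_denominator[OF A(1)] by blast
  have "fsc (of_int D) x = (\<Sum>a\<in>A. fsc (of_int D * c a) a)"
    by (simp add: A(3) fv.scale_sum_right)
  also have "\<dots> \<in> X"
  proof (rule rsub_sum[OF X])
    fix a assume a: "a \<in> A"
    then have "of_int D * c a \<in> R" using D(2) subring_Q_of_int[OF R] by (metis Ints_cases)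
    then show "fsc (of_int D * c a) a \<in> X" using a A(2) rsubD(3)[OF X] by blast
  qed
  finally show ?thesis using D(1) subring_Q_of_int[OF R] by (intro bexI[of _ "of_int D"]) auto
qed

text \<open>The rank over \<open>R\<close> is bounded by a rational dimension. This applies to
  \<open>B/N\<close>, which need not be finitely generated over \<open>R\<close> but embeds in a
  space of finite dimension.\<close>

lemma rank_le_embed:
  assumes M: "rat_module R M" and f: "rlinear R M (fmod UNIV) f" "inj_on f (mcarr M)"
    and T: "f ` mcarr M \<subseteq> fv.span T" "finite T"
  shows "rank_le R M (card T)"
  unfolding rank_le_def
proof (intro allI impI)
  fix S assume S: "indep R M S"
  have R: "subring_Q R" using M by (simp add: rat_module_def)
  have "indep R (fmod UNIV) (f ` S)"
    by (rule indep_inj_image[OF M rat_module_fmod[OF R rsub_UNIV] f S])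
  then have "fv.independent (f ` S)" by (rule independent_if_indep_fmod[OF R])
  moreover have SM: "S \<subseteq> mcarr M" using S by (simp add: indep_def)
  then have "f ` S \<subseteq> fv.span T" using T by blast
  ultimately have "finite (f ` S) \<and> card (f ` S) \<le> card T"
    using fv.independent_span_bound[OF T(2)] by blast
  moreover have "inj_on f S" using f(2) SM by (rule inj_on_subset)
  ultimately show "finite S \<and> card S \<le> card T" by (simp add: card_image finite_image_iff)
qed

section \<open>Evaluation of formal combinations at given generators\<close>

lemma sum_fun_apply: "(sum f A) x = (\<Sum>a\<in>A. f a x)"
  by (induction A rule: infinite_finite_induct) simp_all

definition eval_gens :: "('b \<Rightarrow> 'a \<Rightarrow> rat) \<Rightarrow> ('b \<Rightarrow> rat) \<Rightarrow> 'a \<Rightarrow> rat" where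
  "eval_gens g b = (\<Sum>v | b v \<noteq> 0. fsc (b v) (g v))"

lemma eval_gens_superset:
  assumes "finite A" "{v. b v \<noteq> 0} \<subseteq> A"
  shows "eval_gens g b = (\<Sum>v\<in>A. fsc (b v) (g v))"
  unfolding eval_gens_def using assms by (intro sum.mono_neutral_left) auto

lemma eval_gens_add:
  assumes "finite {v. b v \<noteq> 0}" "finite {v. c v \<noteq> 0}"
  shows "eval_gens g (b + c) = eval_gens g b + eval_gens g c"
proof -
  let ?A = "{v. b v \<noteq> 0} \<union> {v. c v \<noteq> 0}"
  have "eval_gens g (b + c) = (\<Sum>v\<in>?A. fsc ((b + c) v) (g v))"
    using assms by (intro eval_gens_superset) auto
  also have "\<dots> = (\<Sum>v\<in>?A. fsc (b v) (g v)) + (\<Sum>v\<in>?A. fsc (c v) (g v))"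
    by (simp add: fv.scale_left_distrib sum.distrib)
  also have "\<dots> = eval_gens g b + eval_gens g c"
    using assms by (simp add: eval_gens_superset[where A = ?A])
  finally show ?thesis .
qed

lemma eval_gens_fsc:
  assumes "finite {v. b v \<noteq> 0}"
  shows "eval_gens g (fsc r b) = fsc r (eval_gens g b)"
proof -
  have "eval_gens g (fsc r b) = (\<Sum>v | b v \<noteq> 0. fsc (fsc r b v) (g v))"
    using assms by (intro eval_gens_superset) auto
  then show ?thesis by (simp add: eval_gens_def fv.scale_sum_right)
qed

lemma eval_gens_single: "eval_gens g (\<lambda>v. if v = w then 1 else 0) = g w"
  by (subst eval_gens_superset[of "{w}"]) auto

lemma Bmod_eq_fmod: "Bmod R n = fmod (mcarr (Bmod R n))"
  by (simp add: Bmod_def fmod_def fun_eq_iff)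

lemma Bmod_simps [simp]:
  "madd (Bmod R n) = (+)" "mzero (Bmod R n) = 0" "msmul (Bmod R n) = fsc"
  by (simp_all add: Bmod_def fun_eq_iff)

lemma finite_support_Bmod: "b \<in> mcarr (Bmod R n) \<Longrightarrow> finite {v. b v \<noteq> 0}"
  by (simp add: Bmod_def)

section \<open>The modules \<open>B/N\<close>\<close>

locale presentation =
  fixes R :: "rat set" and n :: nat and p :: "nat \<Rightarrow> rat" and k :: "nat \<Rightarrow> nat \<Rightarrow> rat"
  assumes subring: "subring_Q R" and valid: "valid_data R (enat n) p k"
begin

abbreviation "B \<equiv> Bmod R (enat n)"
abbreviation "N \<equiv> Nsub R (enat n) p k"
abbreviation "rel \<equiv> Ngen (enat n) p k"

lemma p_nonzero: "p m \<noteq> 0" and p_in: "p m \<in> R" and k_in: "i < n \<Longrightarrow> k i m \<in> R"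
  using valid by (simp_all add: valid_data_def)

lemma rsub_B: "rsub R (mcarr B)"
proof -
  have "finite {v. b v + c v \<noteq> 0}" if "finite {v. b v \<noteq> 0}" "finite {v. c v \<noteq> 0}"
    for b c :: "nat + nat \<Rightarrow> rat"
    by (rule finite_subset[OF _ finite_UnI[OF that]]) auto
  moreover have "finite {v. r \<noteq> 0 \<and> b v \<noteq> 0}" if "finite {v. b v \<noteq> 0}"
    for b :: "nat + nat \<Rightarrow> rat" and r :: rat
    by (rule finite_subset[OF _ that]) auto
  ultimately show ?thesis using subring
    by (auto simp: rsub_def Bmod_def image_subset_iff subring_Q_0 subring_Q_add subring_Q_mult)
qed

sublocale B: rat_module R B
  using rat_module_fmod[OF subring rsub_B] by (simp flip: Bmod_eq_fmod)

lemma rel_support: "{v. rel m v \<noteq> 0} \<subseteq> Inl ` {..<n} \<union> {Inr m, Inr (Suc m)}"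
proof
  fix v assume "v \<in> {v. rel m v \<noteq> 0}"
  then show "v \<in> Inl ` {..<n} \<union> {Inr m, Inr (Suc m)}"
    by (cases v) (auto simp: Ngen_def split: if_splits)
qed

lemma rel_in_B: "rel m \<in> mcarr B"
proof -
  have "finite {v. rel m v \<noteq> 0}" by (rule finite_subset[OF rel_support]) simp
  moreover have "rel m v \<in> R" for v
    using subring k_in p_in
    by (auto simp: Ngen_def subring_Q_0 subring_Q_1 subring_Q_uminus split: sum.splits)
  ultimately show ?thesis by (auto simp: Bmod_def Ngen_def)
qed

lemma submodule_N: "submodule R B N"
  unfolding Nsub_def using rel_in_B by (intro B.submodule_span) auto

lemma N_subset_B: "N \<subseteq> mcarr B"
  using submodule_N by (simp add: submodule_def)

lemma rsub_N: "rsub R N"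
  using submodule_N by (auto simp: submodule_def rsub_def)

lemma rel_in_N: "rel m \<in> N"
  unfolding Nsub_def using B.span_superset[of "range rel"] rel_in_B by auto

sublocale quot: rat_module R "pres_mod R (enat n) p k"
  unfolding pres_mod_def by (rule B.rat_module_quot[OF submodule_N])

section \<open>Homomorphisms on \<open>B\<close> with prescribed values on the relators\<close>

lemma rlinear_eval_gens:
  assumes "rsub R Y" "\<And>i. i < n \<Longrightarrow> g (Inl i) \<in> Y" "\<And>m. g (Inr m) \<in> Y"
  shows "rlinear R B (fmod Y) (eval_gens g)"
proof -
  have "eval_gens g b \<in> Y" if b: "b \<in> mcarr B" for b
    unfolding eval_gens_def
  proof (rule rsub_sum[OF assms(1)])
    fix v assume "v \<in> {v. b v \<noteq> 0}"
    then have "b v \<in> R" "g v \<in> Y" using assms b by (cases v; auto simp: Bmod_def)+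
    then show "fsc (b v) (g v) \<in> Y" using rsubD(3)[OF assms(1)] by blast
  qed
  then show ?thesis unfolding rlinear_def
    by (simp add: image_subset_iff eval_gens_add eval_gens_fsc finite_support_Bmod)
qed

text \<open>The images of the generators under the \<open>\<rat>\<close>-linear extension of a map \<open>\<psi>\<close> on the relators
  that sends \<open>x\<^sub>i\<close> to \<open>X i\<close> and \<open>y\<^sub>0\<close> to \<open>y\<close>.\<close>

primrec ygen :: "(nat \<Rightarrow> 'a \<Rightarrow> rat) \<Rightarrow> ('a \<Rightarrow> rat) \<Rightarrow> (nat \<Rightarrow> 'a \<Rightarrow> rat) \<Rightarrow> nat \<Rightarrow> 'a \<Rightarrow> rat" where
  "ygen X y \<psi> 0 = y"
| "ygen X y \<psi> (Suc m) = fsc (1 / p m) (ygen X y \<psi> m + (\<Sum>i<n. fsc (k i m) (X i)) + \<psi> m)"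

definition gens :: "(nat \<Rightarrow> 'a \<Rightarrow> rat) \<Rightarrow> ('a \<Rightarrow> rat) \<Rightarrow> (nat \<Rightarrow> 'a \<Rightarrow> rat) \<Rightarrow> nat + nat \<Rightarrow> 'a \<Rightarrow> rat" where
  "gens X y \<psi> = case_sum X (ygen X y \<psi>)"

lemma gens_simps [simp]: "gens X y \<psi> (Inl i) = X i" "gens X y \<psi> (Inr m) = ygen X y \<psi> m"
  by (simp_all add: gens_def)

lemma sum_gens_split:
  "finite A \<Longrightarrow> (\<Sum>v\<in>Inl ` {..<n} \<union> Inr ` A. h v) = (\<Sum>i<n. h (Inl i)) + (\<Sum>m\<in>A. h (Inr m))"
  by (subst sum.union_disjoint) (auto simp: sum.reindex)

text \<open>The recursion for \<open>ygen\<close> is this equation solved for the image of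
  \<open>y_(m+1)\<close>, which is possible because \<open>p m \<noteq> 0\<close>.\<close>

lemma eval_rel: "eval_gens (gens X y \<psi>) (rel m) = \<psi> m"
proof
  fix x
  have *: "Inl ` {..<n} \<union> {Inr m, Inr (Suc m)} = Inl ` {..<n} \<union> Inr ` {m, Suc m}" by auto
  have "eval_gens (gens X y \<psi>) (rel m) x =
      (\<Sum>v\<in>Inl ` {..<n} \<union> Inr ` {m, Suc m}. rel m v * gens X y \<psi> v x)"
    using rel_support[of m] unfolding *
    by (subst eval_gens_superset[where A = "Inl ` {..<n} \<union> Inr ` {m, Suc m}"])
      (simp_all add: sum_fun_apply)
  also have "\<dots> = (\<Sum>i<n. - k i m * X i x) - ygen X y \<psi> m x + p m * ygen X y \<psi> (Suc m) x"
    by (subst sum_gens_split) (simp_all add: Ngen_def)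
  also have "\<dots> = \<psi> m x"
    using p_nonzero[of m] by (simp add: sum_fun_apply sum_negf)
  finally show "eval_gens (gens X y \<psi>) (rel m) x = \<psi> m x" .
qed

text \<open>Since the relators generate \<open>N\<close>, a homomorphism on \<open>N\<close> is
  known from a countable sequence of values. This is why it suffices to enumerate sequences.\<close>

lemma rlinear_eq_on_N:
  assumes L: "rat_module R L" and f: "rlinear R (submod B N) L f" "rlinear R (submod B N) L g"
    and eq: "\<And>m. f (rel m) = g (rel m)" and b: "b \<in> N"
  shows "f b = g b"
proof -
  obtain cs xs where xs: "b = lincomb B cs xs" "set xs \<subseteq> range rel" "set cs \<subseteq> R"
    using b by (auto simp: Nsub_def span_def)
  note N = B.rmodule_submod[OF submodule_N]
  have "set xs \<subseteq> mcarr (submod B N)" using xs rel_in_N by auto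
  then have "f b = lincomb L cs (map f xs)" "g b = lincomb L cs (map g xs)"
    using rlinear_lincomb[OF N L f(1), of xs cs] rlinear_lincomb[OF N L f(2), of xs cs] xs by simp_all
  moreover have "map f xs = map g xs" using xs(2) eq by auto
  ultimately show ?thesis by simp
qed

text \<open>The images of the generators may have denominators and lie outside \<open>Y\<close>. On
  \<open>N\<close> this cancels, because its elements are combinations over \<open>R\<close> of
  relators, whose images are the \<open>\<psi> m\<close>.\<close>

lemma eval_N:
  assumes Y: "rsub R Y" "\<And>m. \<psi> m \<in> Y" and b: "b \<in> N"
  shows "eval_gens (gens X y \<psi>) b \<in> Y"
proof -
  let ?f = "eval_gens (gens X y \<psi>)"
  obtain cs xs where xs: "b = lincomb B cs xs" "set xs \<subseteq> range rel" "set cs \<subseteq> R"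
    using b by (auto simp: Nsub_def span_def)
  \<comment> \<open>The combination is computed in the whole space, where all generators have
    images; by then only the images of relators occur, so it can be read in
    \<open>Y\<close>.\<close>
  have "?f b = lincomb (fmod UNIV) cs (map ?f xs)"
    unfolding xs(1) using xs rel_in_B
    by (intro rlinear_lincomb[OF B.rat_module_axioms rat_module_fmod[OF subring rsub_UNIV]
        rlinear_eval_gens[OF rsub_UNIV]]) auto
  also have "\<dots> = lincomb (fmod Y) cs (map ?f xs)" by (rule lincomb_fmod_eq)
  also have "\<dots> \<in> mcarr (fmod Y)"
    using xs Y(2) by (intro rat_module.lincomb_in[OF rat_module_fmod[OF subring Y(1)]])
      (auto simp: eval_rel subset_iff)
  finally show ?thesis by simp
qed

text \<open>Modulo the relators, \<open>y_j\<close> equals \<open>y_(j+1) p_j\<close> minus a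
  combination of the \<open>x_i\<close>. Adding \<open>b' (Inr j)\<close> times relator j therefore
  pushes the coefficient of \<open>y_j\<close> up by one index, until only \<open>y_M\<close> is
  left.\<close>

lemma reduce_mod_N:
  assumes b: "b \<in> mcarr B" and M: "\<And>m. m > M \<Longrightarrow> b (Inr m) = 0"
  obtains b' \<nu> where "b' \<in> mcarr B" "\<nu> \<in> N" "b = b' + \<nu>" "\<And>m. m \<noteq> M \<Longrightarrow> b' (Inr m) = 0"
proof -
  have "\<exists>b'\<in>mcarr B. \<exists>\<nu>\<in>N. b = b' + \<nu> \<and> (\<forall>m. m < j \<or> m > M \<longrightarrow> b' (Inr m) = 0)" if "j \<le> M" for j
    using that
  proof (induction j)
    case 0
    have "b = b + 0" by simp
    then show ?case using b M rsubD(1)[OF rsub_N] by (intro bexI[of _ b] bexI[of _ 0]) auto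
  next
    case (Suc j)
    then obtain b' \<nu> where IH: "b' \<in> mcarr B" "\<nu> \<in> N" "b = b' + \<nu>"
      "\<forall>m. m < j \<or> m > M \<longrightarrow> b' (Inr m) = 0" using Suc_leD by blast
    define c where "c = b' (Inr j)"
    have "c \<in> R" using IH(1) by (auto simp: c_def Bmod_def)
    then have c: "c \<in> R" "- c \<in> R" using subring by (simp_all add: subring_Q_uminus)
    have "b' + fsc c (rel j) \<in> mcarr B"
      using IH(1) c rel_in_B rsubD(2,3)[OF rsub_B] by blast
    moreover have "\<nu> + fsc (- c) (rel j) \<in> N"
      using IH(2) c rel_in_N rsubD(2,3)[OF rsub_N] by blast
    moreover have "b = (b' + fsc c (rel j)) + (\<nu> + fsc (- c) (rel j))"
      unfolding IH(3) by (simp add: fun_eq_iff)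
    moreover have "\<forall>m. m < Suc j \<or> m > M \<longrightarrow> (b' + fsc c (rel j)) (Inr m) = 0"
      using IH(4) Suc.prems by (auto simp: Ngen_def c_def less_Suc_eq)
    ultimately show ?case by blast
  qed
  from this[OF order.refl] show ?thesis using that by (metis linorder_neqE_nat)
qed

text \<open>The \<open>q j\<close> are test coordinates: \<open>q 0\<close> for \<open>y_0\<close>
  and \<open>q (Suc i)\<close> for \<open>x_i\<close>, all invisible to the \<open>\<psi> m\<close>.
  After reduction modulo \<open>N\<close> the entry at \<open>q 0\<close> determines the coefficient
  of the only remaining \<open>y_M\<close>; once it is zero, the other entries are the coefficients
  of the \<open>x_i\<close>.\<close>

lemma kernel_eval_subset_N:
  assumes b: "b \<in> mcarr B" and 0: "\<And>j. eval_gens (gens X y \<psi>) b (q j) = 0"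
    and X: "\<And>i j. X i (q j) = (if j = Suc i then 1 else 0)"
    and y: "\<And>j. y (q j) = (if j = 0 then 1 else 0)" and \<psi>: "\<And>m j. \<psi> m (q j) = 0"
  shows "b \<in> N"
proof -
  let ?f = "eval_gens (gens X y \<psi>)"
  have "finite (Inr -` {v. b v \<noteq> 0} :: nat set)"
    using finite_support_Bmod[OF b] by (intro finite_vimageI) auto
  then obtain M where "\<forall>m\<in>Inr -` {v. b v \<noteq> 0}. m \<le> M" using finite_nat_set_iff_bounded_le by blast
  then have "\<And>m. m > M \<Longrightarrow> b (Inr m) = 0" by (metis leD mem_Collect_eq vimageI)
  then obtain b' \<nu> where b': "b' \<in> mcarr B" "\<nu> \<in> N" "b = b' + \<nu>" "\<And>m. m \<noteq> M \<Longrightarrow> b' (Inr m) = 0"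
    using reduce_mod_N[OF b] by blast
  \<comment> \<open>The functions vanishing at all test coordinates form a submodule containing
    every \<open>\<psi> m\<close>, hence also the image of the part in \<open>N\<close>.\<close>
  have "rsub R {f. \<forall>j. f (q j) = 0}" by (simp add: rsub_def)
  then have "?f \<nu> (q j) = 0" for j
    using eval_N[of "{f. \<forall>j. f (q j) = 0}" \<psi> \<nu> X y] \<psi> b'(2) by simp
  moreover have "?f b = ?f b' + ?f \<nu>"
    unfolding b'(3) using b' N_subset_B by (intro eval_gens_add finite_support_Bmod) auto
  ultimately have f0: "?f b' (q j) = 0" for j using 0[of j] by simp
  have f: "?f b' (q j) = (\<Sum>i<n. b' (Inl i) * X i (q j)) + b' (Inr M) * ygen X y \<psi> M (q j)" for j
  proof -
    have "{v. b' v \<noteq> 0} \<subseteq> Inl ` {..<n} \<union> Inr ` {M}"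
    proof
      fix v assume "v \<in> {v. b' v \<noteq> 0}"
      then show "v \<in> Inl ` {..<n} \<union> Inr ` {M}" using b'(1,4) by (cases v) (auto simp: Bmod_def)
    qed
    then have "?f b' (q j) = (\<Sum>v\<in>Inl ` {..<n} \<union> Inr ` {M}. b' v * gens X y \<psi> v (q j))"
      by (subst eval_gens_superset[where A = "Inl ` {..<n} \<union> Inr ` {M}"]) (simp_all add: sum_fun_apply)
    then show ?thesis by (subst (asm) sum_gens_split) simp_all
  qed
  \<comment> \<open>At \<open>q 0\<close> the \<open>X i\<close> and \<open>\<psi> m\<close> vanish,
    so each step of the recursion only divides the entry by \<open>p m\<close>.\<close>
  have "ygen X y \<psi> m (q 0) \<noteq> 0" for m
    by (induction m) (simp_all add: y X \<psi> sum_fun_apply p_nonzero)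
  then have M0: "b' (Inr M) = 0" using f[of 0] f0[of 0] by (simp add: X)
  have "b' (Inl i) = 0" if "i < n" for i
    using f[of "Suc i"] f0[of "Suc i"] M0 that by (simp add: X if_distrib cong: if_cong)
  moreover have "b' (Inl i) = 0" if "\<not> i < n" for i using b'(1) that by (simp add: Bmod_def)
  moreover have "b' (Inr m) = 0" for m using b'(4) M0 by (cases "m = M") auto
  ultimately have "b' v = 0" for v by (cases v) blast+
  then have "b' = 0" by (simp add: fun_eq_iff)
  then show ?thesis using b' by simp
qed

text \<open>Taking \<open>\<psi> = 0\<close> and unit vectors for \<open>y_0\<close> and the
  \<open>x_i\<close> kills exactly \<open>N\<close>, so \<open>B/N\<close> embeds in a rational
  space spanned by those unit vectors, one for \<open>y_0\<close> and one for each of the n many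
  \<open>x_i\<close>.\<close>

lemma rank_le_pres_mod: "rank_le R (pres_mod R (enat n) p k) (Suc n)"
proof -
  define u :: "nat \<Rightarrow> nat \<Rightarrow> rat" where "u = (\<lambda>i j. if j = i then 1 else 0)"
  define g where "g = gens (\<lambda>i. u (Suc i)) (u 0) (\<lambda>_. 0)"
  define T where "T = u ` {..n}"
  note F = rat_module_fmod[OF subring rsub_UNIV]
  have lin: "rlinear R B (fmod UNIV) (eval_gens g)" by (rule rlinear_eval_gens[OF rsub_UNIV]) auto
  have ker: "eval_gens g b = 0" if "b \<in> N" for b
    using eval_N[of "{0}" "\<lambda>_. 0" b] that by (simp add: g_def rsub_def)
  define h where "h = (\<lambda>Z. eval_gens g (SOME x. x \<in> Z))"
  have h: "h (coset B N b) = eval_gens g b" if "b \<in> mcarr B" for b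
    unfolding h_def by (rule B.quot_lift_coset[OF submodule_N F lin]) (use ker that in auto)
  have h_lin: "rlinear R (pres_mod R (enat n) p k) (fmod UNIV) h"
    unfolding h_def pres_mod_def by (rule B.quot_lift_rlinear[OF submodule_N F lin]) (use ker in auto)
  have ex: "\<exists>b\<in>mcarr B. Z = coset B N b" if "Z \<in> mcarr (pres_mod R (enat n) p k)" for Z
    using that by (auto simp: pres_mod_def mcarr_quot)
  have "inj_on h (mcarr (pres_mod R (enat n) p k))"
  proof (rule quot.rlinear_inj_onI[OF F h_lin])
    fix Z assume "Z \<in> mcarr (pres_mod R (enat n) p k)" "h Z = mzero (fmod UNIV)"
    then obtain b where b: "b \<in> mcarr B" "Z = coset B N b" "eval_gens g b = 0"
      using ex h by force
    have "b \<in> N"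
      by (rule kernel_eval_subset_N[OF b(1), of _ _ _ id, OF b(3)[unfolded g_def fun_eq_iff, rule_format, THEN trans]])
        (simp_all add: u_def)
    then show "Z = mzero (pres_mod R (enat n) p k)"
      using B.coset_eq_zero_iff[OF submodule_N b(1)] b(2) by (simp add: pres_mod_def)
  qed
  moreover have "h ` mcarr (pres_mod R (enat n) p k) \<subseteq> fv.span T"
  proof
    fix z assume "z \<in> h ` mcarr (pres_mod R (enat n) p k)"
    then obtain b where b: "b \<in> mcarr B" "z = eval_gens g b" using ex h by force
    have u: "u i \<in> fv.span T" if "i \<le> n" for i using that by (auto simp: T_def intro: fv.span_base)
    have "ygen (\<lambda>i. u (Suc i)) (u 0) (\<lambda>_. 0) m \<in> fv.span T" for m
    proof (induction m)
      case 0
      show ?case unfolding ygen.simps by (rule u) simp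
    next
      case (Suc m)
      show ?case unfolding ygen.simps
        by (intro fv.span_add fv.span_scale fv.span_sum fv.span_zero u Suc) simp
    qed
    then have "g v \<in> fv.span T" if "b v \<noteq> 0" for v
    proof (cases v)
      case (Inl i)
      then have "i < n" using that b(1) by (auto simp: Bmod_def)
      then show ?thesis using u[of "Suc i"] Inl by (simp add: g_def)
    qed (simp add: g_def)
    then show "z \<in> fv.span T" unfolding b(2) eval_gens_def
      by (intro fv.span_sum fv.span_scale) blast
  qed
  ultimately have "rank_le R (pres_mod R (enat n) p k) (card T)"
    by (intro rank_le_embed[OF quot.rat_module_axioms h_lin]) (simp_all add: T_def)
  moreover have "card T \<le> Suc n" unfolding T_def using card_image_le[of "{..n}" u] by simp
  ultimately show ?thesis unfolding rank_le_def by (meson le_trans)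
qed

end

lemma rsub_diff: "subring_Q R \<Longrightarrow> rsub R X \<Longrightarrow> x \<in> X \<Longrightarrow> y \<in> X \<Longrightarrow> x - y \<in> X"
  using rsubD(2)[of R X x "fsc (-1) y"] rsubD(3)[of R X "-1" y]
  by (simp add: subring_Q_1 subring_Q_uminus)

lemma rlinear_submod:
  assumes "rlinear R M L f" "K \<subseteq> mcarr M" shows "rlinear R (submod M K) L f"
  unfolding rlinear_def submod_simps
proof (intro conjI ballI)
  show "f ` K \<subseteq> mcarr L" using assms unfolding rlinear_def by blast
qed (use assms in \<open>simp_all add: rlinear_def subsetD\<close>)

lemma rsub_zero: "rsub R {0}"
  by (simp add: rsub_def)

lemma rank_le_fmod_mono: "rank_le R (fmod Y) n \<Longrightarrow> X \<subseteq> Y \<Longrightarrow> rank_le R (fmod X) n"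
  using indep_submod[of R "fmod Y" X] by (simp add: rank_le_def)

lemma free_fmod_zero: "free R (fmod {0 :: 'a \<Rightarrow> rat})"
proof -
  have "span R (fmod {0 :: 'a \<Rightarrow> rat}) {} = {0}" by (auto simp: span_def)
  moreover have "indep R (fmod {0 :: 'a \<Rightarrow> rat}) {}" by (simp add: indep_def)
  ultimately show ?thesis unfolding free_def by (metis fmod_simps(1))
qed

section \<open>The chain\<close>

text \<open>Each index carries one task: a presentation and a candidate sequence of values on its
  relators. The injection \<open>b\<close> reserves countably many coordinates for every index, and
  \<open>no_max\<close> places the result of every step inside a later stage.\<close>

locale tower = ord: wellorder le lt
  for le :: "'k \<Rightarrow> 'k \<Rightarrow> bool" (infix "\<sqsubseteq>" 50) and lt :: "'k \<Rightarrow> 'k \<Rightarrow> bool" (infix "\<sqsubset>" 50) +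
  fixes R :: "rat set" and num :: "'k \<Rightarrow> nat" and pp :: "'k \<Rightarrow> nat \<Rightarrow> rat"
    and kk :: "'k \<Rightarrow> nat \<Rightarrow> nat \<Rightarrow> rat" and \<psi> :: "'k \<Rightarrow> nat \<Rightarrow> 'k \<Rightarrow> rat"
    and b :: "'k \<times> nat \<Rightarrow> 'k"
  assumes subring: "subring_Q R" and valid: "valid_data R (enat (num \<alpha>)) (pp \<alpha>) (kk \<alpha>)"
    and inj_b: "inj b" and no_max: "\<exists>\<beta>. \<alpha> \<sqsubset> \<beta>"
begin

lemma pres: "presentation R (num \<alpha>) (pp \<alpha>) (kk \<alpha>)"
  by (simp add: presentation_def subring valid)

definition e :: "'k \<Rightarrow> nat \<Rightarrow> 'k \<Rightarrow> rat" where
  "e \<alpha> j = (\<lambda>x. if x = b (\<alpha>, j) then 1 else 0)"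

lemma e_apply: "e \<alpha> i (b (\<beta>, j)) = (if \<alpha> = \<beta> \<and> i = j then 1 else 0)"
  using inj_b by (auto simp: e_def inj_def)

definition gn :: "'k \<Rightarrow> nat + nat \<Rightarrow> 'k \<Rightarrow> rat" where
  "gn \<alpha> = presentation.gens (num \<alpha>) (pp \<alpha>) (kk \<alpha>) (\<lambda>i. e \<alpha> (Suc i)) (e \<alpha> 0) (\<psi> \<alpha>)"

abbreviation "B \<alpha> \<equiv> Bmod R (enat (num \<alpha>))"
abbreviation "N \<alpha> \<equiv> Nsub R (enat (num \<alpha>)) (pp \<alpha>) (kk \<alpha>)"
abbreviation "Q \<alpha> \<equiv> pres_mod R (enat (num \<alpha>)) (pp \<alpha>) (kk \<alpha>)"
abbreviation "F \<alpha> \<equiv> eval_gens (gn \<alpha>)"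

text \<open>The generators attached to \<open>\<beta>\<close> only enter the chain if the homomorphism \<open>\<psi> \<beta>\<close> to be
  extended takes its values in what has been built before stage \<open>\<beta>\<close>.\<close>

inductive stage :: "'k \<Rightarrow> ('k \<Rightarrow> rat) \<Rightarrow> bool" where
  zero: "stage \<alpha> 0"
| add: "stage \<alpha> u \<Longrightarrow> stage \<alpha> v \<Longrightarrow> stage \<alpha> (u + v)"
| smul: "r \<in> R \<Longrightarrow> stage \<alpha> v \<Longrightarrow> stage \<alpha> (fsc r v)"
| gen: "\<beta> \<sqsubset> \<alpha> \<Longrightarrow> \<forall>m. stage \<beta> (\<psi> \<beta> m) \<Longrightarrow> w \<in> Inl ` {..<num \<beta>} \<union> range Inr \<Longrightarrow> stage \<alpha> (gn \<beta> w)"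

definition C :: "'k \<Rightarrow> ('k \<Rightarrow> rat) set" where
  "C \<alpha> = {v. stage \<alpha> v}"

definition good :: "'k \<Rightarrow> bool" where
  "good \<alpha> \<longleftrightarrow> (\<forall>m. \<psi> \<alpha> m \<in> C \<alpha>)"

definition E :: "'k \<Rightarrow> ('k \<Rightarrow> rat) set" where
  "E \<alpha> = (if good \<alpha> then F \<alpha> ` mcarr (B \<alpha>) else {0})"

text \<open>This is the stage following \<open>\<alpha>\<close>, written without a successor
  operation on the indices; at an index that is not good it coincides with
  \<open>C \<alpha>\<close>.\<close>

definition D :: "'k \<Rightarrow> ('k \<Rightarrow> rat) set" where
  "D \<alpha> = {u + v | u v. u \<in> C \<alpha> \<and> v \<in> E \<alpha>}"

definition G :: "('k \<Rightarrow> rat) set" where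
  "G = (\<Union>\<alpha>. C \<alpha>)"

section \<open>Stages as submodules, and their fresh coordinates\<close>

lemma rsub_C: "rsub R (C \<alpha>)"
  by (simp add: rsub_def C_def stage.zero stage.add stage.smul)

lemma C_mono: assumes "\<alpha> \<sqsubseteq> \<beta>" shows "C \<alpha> \<subseteq> C \<beta>"
proof -
  have "stage \<beta> v" if "stage \<alpha> v" for v
    using that assms
    by (induction rule: stage.induct) (auto intro: stage.intros ord.less_le_trans)
  then show ?thesis by (auto simp: C_def)
qed

lemma F_rlinear_UNIV: "rlinear R (B \<alpha>) (fmod UNIV) (F \<alpha>)"
  by (rule presentation.rlinear_eval_gens[OF pres rsub_UNIV]) auto

lemma rsub_E: "rsub R (E \<alpha>)"
proof (cases "good \<alpha>")
  case True
  interpret P: presentation R "num \<alpha>" "pp \<alpha>" "kk \<alpha>" by (rule pres)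
  have "submodule R (fmod UNIV) (F \<alpha> ` mcarr (B \<alpha>))"
    by (rule submodule_image[OF P.B.rat_module_axioms rat_module_fmod[OF subring rsub_UNIV] F_rlinear_UNIV])
  then show ?thesis using True by (simp add: E_def submodule_fmod)
qed (simp add: E_def rsub_zero)

lemma rsub_D: "rsub R (D \<alpha>)"
  unfolding rsub_def
proof (intro conjI ballI)
  show "0 \<in> D \<alpha>" unfolding D_def using rsubD(1)[OF rsub_C] rsubD(1)[OF rsub_E]
    by (intro CollectI exI[of _ 0]) simp
next
  fix x y assume "x \<in> D \<alpha>" "y \<in> D \<alpha>"
  then obtain u v u' v' where "x = u + v" "y = u' + v'" "u \<in> C \<alpha>" "v \<in> E \<alpha>" "u' \<in> C \<alpha>" "v' \<in> E \<alpha>"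
    unfolding D_def by blast
  then show "x + y \<in> D \<alpha>" unfolding D_def
    using rsubD(2)[OF rsub_C] rsubD(2)[OF rsub_E]
    by (intro CollectI exI[of _ "u + u'"] exI[of _ "v + v'"]) (simp add: add_ac)
next
  fix r x assume "r \<in> R" "x \<in> D \<alpha>"
  then obtain u v where "r \<in> R" "x = u + v" "u \<in> C \<alpha>" "v \<in> E \<alpha>" unfolding D_def by blast
  then show "fsc r x \<in> D \<alpha>" unfolding D_def
    using rsubD(3)[OF rsub_C] rsubD(3)[OF rsub_E]
    by (intro CollectI exI[of _ "fsc r u"] exI[of _ "fsc r v"]) (simp add: fv.scale_right_distrib)
qed

lemma C_subset_D: "C \<alpha> \<subseteq> D \<alpha>"
proof
  fix u assume "u \<in> C \<alpha>"
  then show "u \<in> D \<alpha>" unfolding D_def using rsubD(1)[OF rsub_E]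
    by (intro CollectI exI[of _ u] exI[of _ 0]) simp
qed

lemma E_subset_D: "E \<alpha> \<subseteq> D \<alpha>"
proof
  fix u assume "u \<in> E \<alpha>"
  then show "u \<in> D \<alpha>" unfolding D_def using rsubD(1)[OF rsub_C]
    by (intro CollectI exI[of _ 0] exI[of _ u]) simp
qed

lemma D_bad: "\<not> good \<alpha> \<Longrightarrow> D \<alpha> = C \<alpha>"
  unfolding D_def E_def by simp

lemma gn_in_C: "good \<beta> \<Longrightarrow> \<beta> \<sqsubset> \<alpha> \<Longrightarrow> w \<in> Inl ` {..<num \<beta>} \<union> range Inr \<Longrightarrow> gn \<beta> w \<in> C \<alpha>"
  using stage.gen by (simp add: good_def C_def)

lemma D_subset_C: assumes "\<alpha> \<sqsubset> \<beta>" shows "D \<alpha> \<subseteq> C \<beta>"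
proof -
  have "E \<alpha> \<subseteq> C \<beta>"
  proof (cases "good \<alpha>")
    case True
    have "rlinear R (B \<alpha>) (fmod (C \<beta>)) (F \<alpha>)"
      by (rule presentation.rlinear_eval_gens[OF pres rsub_C])
        (use gn_in_C[OF True assms] in auto)
    then show ?thesis using True by (simp add: E_def rlinear_def)
  qed (simp add: E_def rsubD(1)[OF rsub_C])
  then show ?thesis using C_mono[of \<alpha> \<beta>] assms rsubD(2)[OF rsub_C, of _ \<beta>]
    unfolding D_def by (auto dest: ord.less_imp_le)
qed

lemma D_mono: "\<alpha> \<sqsubseteq> \<beta> \<Longrightarrow> D \<alpha> \<subseteq> D \<beta>"
  using D_subset_C C_subset_D ord.le_imp_less_or_eq by blast

lemma gn_in_D:
  assumes "good \<beta>" "w \<in> Inl ` {..<num \<beta>} \<union> range Inr" shows "gn \<beta> w \<in> D \<beta>"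
proof -
  have "(\<lambda>v. if v = w then 1 else 0) \<in> mcarr (B \<beta>)"
    using assms(2) subring by (auto simp: Bmod_def subring_Q_0 subring_Q_1)
  then have "gn \<beta> w \<in> E \<beta>" using assms(1) eval_gens_single[of "gn \<beta>" w]
    unfolding E_def by (metis image_eqI)
  then show ?thesis using E_subset_D by blast
qed

text \<open>This treats least, successor and limit indices uniformly: the \<open>D \<delta>\<close>
  form a chain, so a sum lies in the larger of two of them. The separate case \<open>v = 0\<close>
  accounts for the least index, below which there is no \<open>\<delta>\<close>.\<close>

lemma C_cases:
  assumes "v \<in> C \<alpha>"
  obtains "v = 0" | \<delta> where "\<delta> \<sqsubset> \<alpha>" "v \<in> D \<delta>"
proof -
  have "stage \<alpha> v \<Longrightarrow> v = 0 \<or> (\<exists>\<delta>. \<delta> \<sqsubset> \<alpha> \<and> v \<in> D \<delta>)"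
  proof (induction rule: stage.induct)
    case (add \<alpha> u v)
    show ?case
    proof (cases "u = 0 \<or> v = 0")
      case False
      then obtain \<delta> \<delta>' where *: "\<delta> \<sqsubset> \<alpha>" "u \<in> D \<delta>" "\<delta>' \<sqsubset> \<alpha>" "v \<in> D \<delta>'" using add.IH by blast
      consider "\<delta> \<sqsubseteq> \<delta>'" | "\<delta>' \<sqsubseteq> \<delta>" using ord.linear by blast
      then show ?thesis
      proof cases
        case 1
        then have "u + v \<in> D \<delta>'" using * D_mono rsubD(2)[OF rsub_D] by blast
        then show ?thesis using * by blast
      next
        case 2
        then have "u + v \<in> D \<delta>" using * D_mono rsubD(2)[OF rsub_D] by blast
        then show ?thesis using * by blast
      qed
    qed (use add.IH in auto)
  next
    case (smul r \<alpha> v)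
    then show ?case using rsubD(3)[OF rsub_D, of r] by (metis fv.scale_zero_right)
  next
    case (gen \<beta> \<alpha> w)
    then have "good \<beta>" by (simp add: good_def C_def)
    then show ?case using gen gn_in_D by blast
  qed simp
  then show ?thesis using assms that by (auto simp: C_def)
qed

text \<open>The coordinates of \<open>\<beta>\<close> are fresh: generators attached to some
  \<open>\<gamma> \<sqsubset> \<beta>\<close> are built from coordinates of \<open>\<gamma>\<close>
  and from the values \<open>\<psi> \<gamma> m\<close>, which belong to the earlier stage
  \<open>\<gamma>\<close>.\<close>

lemma vanish: assumes "v \<in> C \<alpha>" "\<alpha> \<sqsubseteq> \<beta>" shows "v (b (\<beta>, j)) = 0"
proof -
  have "stage \<alpha> v \<Longrightarrow> \<alpha> \<sqsubseteq> \<beta> \<longrightarrow> v (b (\<beta>, j)) = 0"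
  proof (induction rule: stage.induct)
    case (gen \<gamma> \<alpha> w)
    interpret P: presentation R "num \<gamma>" "pp \<gamma>" "kk \<gamma>" by (rule pres)
    show ?case
    proof
      assume "\<alpha> \<sqsubseteq> \<beta>"
      then have \<gamma>: "\<gamma> \<sqsubset> \<beta>" using gen.hyps(1) by (rule ord.less_le_trans[rotated])
      then have e0: "e \<gamma> i (b (\<beta>, j)) = 0" for i by (auto simp: e_apply)
      have "P.ygen (\<lambda>i. e \<gamma> (Suc i)) (e \<gamma> 0) (\<psi> \<gamma>) m (b (\<beta>, j)) = 0" for m
        by (induction m) (use \<gamma> e0 gen.IH in \<open>simp_all add: sum_fun_apply ord.less_imp_le\<close>)
      then show "gn \<gamma> w (b (\<beta>, j)) = 0" using gen.hyps(2) e0 by (auto simp: gn_def)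
    qed
  qed simp_all
  then show ?thesis using assms by (simp add: C_def)
qed

text \<open>This has two uses: the enumeration only promises to meet sequences of finitely supported
  functions, and counting such functions bounds the rank from above.\<close>

lemma finite_support: assumes "v \<in> G" shows "finite {x. v x \<noteq> 0}"
proof -
  have fin_add: "finite {x. u x + v x \<noteq> 0}"
    if "finite {x. u x \<noteq> 0}" "finite {x. v x \<noteq> 0}" for u v :: "'k \<Rightarrow> rat"
    by (rule finite_subset[OF _ finite_UnI[OF that]]) auto
  have fin_smul: "finite {x. r * v x \<noteq> 0}" if "finite {x. v x \<noteq> 0}" for r and v :: "'k \<Rightarrow> rat"
    by (rule finite_subset[OF _ that]) auto
  have "stage \<alpha> v \<Longrightarrow> finite {x. v x \<noteq> 0}" for \<alpha>
  proof (induction rule: stage.induct)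
    case (add \<alpha> u v)
    then show ?case using fin_add[of u v] by simp
  next
    case (smul r \<alpha> v)
    then show ?case using fin_smul[of v r] by simp
  next
    case (gen \<gamma> \<alpha> w)
    interpret P: presentation R "num \<gamma>" "pp \<gamma>" "kk \<gamma>" by (rule pres)
    have e: "finite {x. e \<gamma> i x \<noteq> 0}" for i by (simp add: e_def)
    have s: "finite {x. (\<Sum>i<n. kk \<gamma> i m * e \<gamma> (Suc i) x) \<noteq> 0}" for n m
      by (induction n) (use fin_add fin_smul e in simp_all)
    have "finite {x. P.ygen (\<lambda>i. e \<gamma> (Suc i)) (e \<gamma> 0) (\<psi> \<gamma>) m x \<noteq> 0}" for m
    proof (induction m)
      case (Suc m)
      have "finite {x. 1 / pp \<gamma> m * (P.ygen (\<lambda>i. e \<gamma> (Suc i)) (e \<gamma> 0) (\<psi> \<gamma>) m x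
          + (\<Sum>i<num \<gamma>. kk \<gamma> i m * e \<gamma> (Suc i) x) + \<psi> \<gamma> m x) \<noteq> 0}"
        using gen.IH by (intro fin_smul fin_add Suc s) blast
      then show ?case by (simp add: sum_fun_apply)
    qed (simp add: e)
    then show ?case using gen.hyps(2) e by (auto simp: gn_def)
  qed simp
  then show ?thesis using assms by (auto simp: G_def C_def)
qed

lemma D_subset_G: "D \<alpha> \<subseteq> G"
  using no_max[of \<alpha>] D_subset_C by (auto simp: G_def)

lemma G_eq: "G = (\<Union>\<alpha>. D \<alpha>)"
  using D_subset_G C_subset_D unfolding G_def by blast

lemma rsub_G: "rsub R G"
  unfolding rsub_def
proof (intro conjI ballI)
  fix x y assume "x \<in> G" "y \<in> G"
  then obtain \<alpha> \<beta> where "x \<in> C \<alpha>" "y \<in> C \<beta>" by (auto simp: G_def)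
  then have "\<exists>\<gamma>. x \<in> C \<gamma> \<and> y \<in> C \<gamma>" using C_mono ord.linear[of \<alpha> \<beta>] by blast
  then show "x + y \<in> G" using rsubD(2)[OF rsub_C] by (auto simp: G_def)
next
  show "0 \<in> G" using rsubD(1)[OF rsub_C] by (auto simp: G_def)
  fix r x assume "r \<in> R" "x \<in> G"
  then show "fsc r x \<in> G" using rsubD(3)[OF rsub_C] unfolding G_def by blast
qed

section \<open>Successor quotients and purity\<close>

lemma kernel_F:
  assumes "good \<alpha>" "x \<in> mcarr (B \<alpha>)" "\<And>j. F \<alpha> x (b (\<alpha>, j)) = 0"
  shows "x \<in> N \<alpha>"
proof -
  have "\<psi> \<alpha> m (b (\<alpha>, j)) = 0" for m j using assms(1) vanish[of _ \<alpha> \<alpha>] by (simp add: good_def)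
  then show ?thesis
    by (intro presentation.kernel_eval_subset_N[OF pres assms(2) assms(3)[unfolded gn_def]])
      (simp_all add: e_apply)
qed

text \<open>A step imposes no relations on the new generators modulo \<open>C \<alpha>\<close>
  beyond those in \<open>N \<alpha>\<close>: elements of \<open>C \<alpha>\<close> vanish at the
  coordinates of \<open>\<alpha>\<close>, where only \<open>N \<alpha>\<close> is killed.\<close>

lemma F_in_C_iff:
  assumes "good \<alpha>" "x \<in> mcarr (B \<alpha>)"
  shows "F \<alpha> x \<in> C \<alpha> \<longleftrightarrow> x \<in> N \<alpha>"
proof
  assume "F \<alpha> x \<in> C \<alpha>"
  then show "x \<in> N \<alpha>" using vanish assms by (intro kernel_F) auto
next
  assume "x \<in> N \<alpha>"
  then show "F \<alpha> x \<in> C \<alpha>"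
    unfolding gn_def using presentation.eval_N[OF pres rsub_C] assms(1) by (simp add: good_def)
qed

text \<open>A converse to \<open>vanish\<close> inside \<open>D \<alpha>\<close>. It describes
  \<open>C \<alpha>\<close> there by vanishing coordinates, a condition unaffected by nonzero
  scaling, which is the source of purity.\<close>

lemma D_vanish_in_C:
  assumes "v \<in> D \<alpha>" "\<And>j. v (b (\<alpha>, j)) = 0"
  shows "v \<in> C \<alpha>"
proof (cases "good \<alpha>")
  case True
  then obtain u x where ux: "v = u + F \<alpha> x" "u \<in> C \<alpha>" "x \<in> mcarr (B \<alpha>)"
    using assms(1) by (auto simp: D_def E_def)
  then have "F \<alpha> x (b (\<alpha>, j)) = 0" for j using assms(2)[of j] vanish[OF ux(2), of \<alpha> j] by simp
  then have "F \<alpha> x \<in> C \<alpha>" using kernel_F F_in_C_iff True ux(3) by blast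
  then show ?thesis using ux rsubD(2)[OF rsub_C] by blast
qed (use assms D_bad in blast)

text \<open>Descent on an index \<open>\<epsilon>\<close> with \<open>x \<in> D \<epsilon>\<close>:
  if \<open>\<delta> \<sqsubset> \<epsilon>\<close>, then \<open>fsc r x\<close> lies in
  \<open>C \<epsilon>\<close> and vanishes at the coordinates of \<open>\<epsilon>\<close>. So does
  \<open>x\<close>, which therefore lies in \<open>C \<epsilon>\<close> and is zero or in some
  earlier \<open>D\<close>.\<close>

lemma D_pure:
  assumes "x \<in> G" "r \<noteq> 0" "fsc r x \<in> D \<delta>"
  shows "x \<in> D \<delta>"
proof -
  have "x \<in> D \<epsilon> \<Longrightarrow> x \<in> D \<delta>" for \<epsilon>
  proof (induction \<epsilon> rule: ord.less_induct)
    case (less \<epsilon>)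
    show ?case
    proof (cases "\<epsilon> \<sqsubseteq> \<delta>")
      case False
      then have "\<delta> \<sqsubset> \<epsilon>" by (simp add: ord.not_le)
      then have "fsc r x \<in> C \<epsilon>" using assms(3) D_subset_C by blast
      then have "x (b (\<epsilon>, j)) = 0" for j using vanish[of "fsc r x" \<epsilon> \<epsilon> j] assms(2) by simp
      then have "x \<in> C \<epsilon>" using D_vanish_in_C less.prems by blast
      then show ?thesis
      proof (cases rule: C_cases)
        case 1
        show ?thesis unfolding 1 by (rule rsubD(1)[OF rsub_D])
      qed (use less.IH in blast)
    qed (use less.prems D_mono in blast)
  qed
  then show ?thesis using assms(1) by (auto simp: G_eq)
qed

text \<open>The map sends \<open>u + F \<alpha> x\<close> with \<open>u \<in> C \<alpha>\<close> to
  the coset of \<open>x\<close>. Neither \<open>u\<close> nor \<open>x\<close> is unique, but two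
  choices of \<open>x\<close> differ by an element that \<open>F \<alpha>\<close> sends into
  \<open>C \<alpha>\<close>, hence by an element of \<open>N \<alpha>\<close>.\<close>

lemma step_map:
  assumes "good \<alpha>"
  obtains L where "rlinear R (fmod (D \<alpha>)) (Q \<alpha>) L" "L ` D \<alpha> = mcarr (Q \<alpha>)"
    "C \<alpha> = {x \<in> D \<alpha>. L x = mzero (Q \<alpha>)}"
proof -
  interpret P: presentation R "num \<alpha>" "pp \<alpha>" "kk \<alpha>" by (rule pres)
  have F_add: "F \<alpha> (x + y) = F \<alpha> x + F \<alpha> y" if "x \<in> mcarr (B \<alpha>)" "y \<in> mcarr (B \<alpha>)" for x y
    using F_rlinear_UNIV[of \<alpha>] that by (simp add: rlinear_def)
  have F_fsc: "F \<alpha> (fsc r x) = fsc r (F \<alpha> x)" if "x \<in> mcarr (B \<alpha>)" "r \<in> R" for x r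
    using F_rlinear_UNIV[of \<alpha>] that by (simp add: rlinear_def)
  define ch where "ch v = (SOME x. x \<in> mcarr (B \<alpha>) \<and> v - F \<alpha> x \<in> C \<alpha>)" for v
  define L where "L v = coset (B \<alpha>) (N \<alpha>) (ch v)" for v
  have L: "L v = coset (B \<alpha>) (N \<alpha>) x" if x: "x \<in> mcarr (B \<alpha>)" "v - F \<alpha> x \<in> C \<alpha>" for v x
  proof -
    have y: "ch v \<in> mcarr (B \<alpha>)" "v - F \<alpha> (ch v) \<in> C \<alpha>"
      using someI[of "\<lambda>x. x \<in> mcarr (B \<alpha>) \<and> v - F \<alpha> x \<in> C \<alpha>" x] x by (simp_all add: ch_def)
    define z where "z = ch v - x"
    have z: "z \<in> mcarr (B \<alpha>)" unfolding z_def using x y by (intro rsub_diff[OF subring P.rsub_B])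
    have "ch v = x + z" by (simp add: z_def)
    then have "F \<alpha> z = (v - F \<alpha> x) - (v - F \<alpha> (ch v))" using F_add[OF x(1) z] by simp
    also have "\<dots> \<in> C \<alpha>" by (rule rsub_diff[OF subring rsub_C x(2) y(2)])
    finally have "z \<in> N \<alpha>" using F_in_C_iff[OF assms z] by simp
    then show ?thesis using P.B.coset_add_cancel[OF P.submodule_N x(1), of z] \<open>ch v = x + z\<close>
      by (simp add: L_def)
  qed
  have ex: "\<exists>x\<in>mcarr (B \<alpha>). v - F \<alpha> x \<in> C \<alpha>" if v: "v \<in> D \<alpha>" for v
  proof -
    obtain u x where "v = u + F \<alpha> x" "u \<in> C \<alpha>" "x \<in> mcarr (B \<alpha>)"
      using v assms by (auto simp: D_def E_def)
    then show ?thesis by (intro bexI[of _ x]) simp_all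
  qed
  have "L (u + v) = madd (Q \<alpha>) (L u) (L v)" if uv: "u \<in> D \<alpha>" "v \<in> D \<alpha>" for u v
  proof -
    obtain x where x: "x \<in> mcarr (B \<alpha>)" "u - F \<alpha> x \<in> C \<alpha>" using ex uv by blast
    obtain y where y: "y \<in> mcarr (B \<alpha>)" "v - F \<alpha> y \<in> C \<alpha>" using ex uv by blast
    have "(u + v) - F \<alpha> (x + y) = (u - F \<alpha> x) + (v - F \<alpha> y)"
      unfolding F_add[OF x(1) y(1)] by (simp add: algebra_simps)
    also have "\<dots> \<in> C \<alpha>" using x y rsubD(2)[OF rsub_C] by blast
    finally have "L (u + v) = coset (B \<alpha>) (N \<alpha>) (x + y)"
      using x y rsubD(2)[OF P.rsub_B] by (intro L) blast+
    then show ?thesis using L[OF x] L[OF y] P.B.madd_quot[OF P.submodule_N x(1) y(1)]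
      by (simp add: pres_mod_def)
  qed
  moreover have "L (fsc r v) = msmul (Q \<alpha>) r (L v)" if rv: "r \<in> R" "v \<in> D \<alpha>" for r v
  proof -
    obtain x where x: "x \<in> mcarr (B \<alpha>)" "v - F \<alpha> x \<in> C \<alpha>" using ex rv by blast
    have "fsc r v - F \<alpha> (fsc r x) = fsc r (v - F \<alpha> x)"
      unfolding F_fsc[OF x(1) rv(1)] by (simp add: fv.scale_right_diff_distrib)
    also have "\<dots> \<in> C \<alpha>" using x rv rsubD(3)[OF rsub_C] by blast
    finally have "L (fsc r v) = coset (B \<alpha>) (N \<alpha>) (fsc r x)"
      using x rv rsubD(3)[OF P.rsub_B] by (intro L) blast+
    then show ?thesis using L[OF x] P.B.msmul_quot[OF P.submodule_N rv(1) x(1)]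
      by (simp add: pres_mod_def)
  qed
  moreover have "L v \<in> mcarr (Q \<alpha>)" if v: "v \<in> D \<alpha>" for v
    using ex[OF v] L by (auto simp: pres_mod_def mcarr_quot)
  ultimately have "rlinear R (fmod (D \<alpha>)) (Q \<alpha>) L" by (simp add: rlinear_def image_subset_iff)
  moreover have "L ` D \<alpha> = mcarr (Q \<alpha>)"
  proof
    show "mcarr (Q \<alpha>) \<subseteq> L ` D \<alpha>"
    proof
      fix X assume "X \<in> mcarr (Q \<alpha>)"
      then obtain x where x: "x \<in> mcarr (B \<alpha>)" "X = coset (B \<alpha>) (N \<alpha>) x"
        by (auto simp: pres_mod_def mcarr_quot)
      have "X = L (F \<alpha> x)" using L[of x "F \<alpha> x"] x rsubD(1)[OF rsub_C] by simp
      moreover have "F \<alpha> x \<in> D \<alpha>" using E_subset_D[of \<alpha>] assms x(1) by (auto simp: E_def)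
      ultimately show "X \<in> L ` D \<alpha>" by blast
    qed
  qed (use \<open>\<And>v. v \<in> D \<alpha> \<Longrightarrow> L v \<in> mcarr (Q \<alpha>)\<close> in blast)
  moreover have "L v = mzero (Q \<alpha>) \<longleftrightarrow> v \<in> C \<alpha>" if v: "v \<in> D \<alpha>" for v
  proof -
    obtain x where x: "x \<in> mcarr (B \<alpha>)" "v - F \<alpha> x \<in> C \<alpha>" using ex v by blast
    have "L v = mzero (Q \<alpha>) \<longleftrightarrow> F \<alpha> x \<in> C \<alpha>"
      using P.B.coset_eq_zero_iff[OF P.submodule_N x(1)] L[OF x] F_in_C_iff[OF assms x(1)]
      by (simp add: pres_mod_def)
    also have "\<dots> \<longleftrightarrow> v \<in> C \<alpha>"
    proof
      assume "F \<alpha> x \<in> C \<alpha>"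
      then show "v \<in> C \<alpha>" using x(2) rsubD(2)[OF rsub_C, of "v - F \<alpha> x" \<alpha> "F \<alpha> x"] by simp
    next
      assume "v \<in> C \<alpha>"
      then show "F \<alpha> x \<in> C \<alpha>" using x(2) rsub_diff[OF subring rsub_C, of v \<alpha> "v - F \<alpha> x"] by simp
    qed
    finally show ?thesis .
  qed
  then have "C \<alpha> = {x \<in> D \<alpha>. L x = mzero (Q \<alpha>)}" using C_subset_D by blast
  ultimately show ?thesis using that by blast
qed

lemma step_quotient:
  "free R (quot (fmod (D \<alpha>)) (C \<alpha>)) \<or> good \<alpha> \<and> iso R (quot (fmod (D \<alpha>)) (C \<alpha>)) (Q \<alpha>)"
proof (cases "good \<alpha>")
  case True
  interpret P: presentation R "num \<alpha>" "pp \<alpha>" "kk \<alpha>" by (rule pres)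
  obtain L where L: "rlinear R (fmod (D \<alpha>)) (Q \<alpha>) L" "L ` D \<alpha> = mcarr (Q \<alpha>)"
    "C \<alpha> = {x \<in> D \<alpha>. L x = mzero (Q \<alpha>)}" using step_map[OF True] .
  have "iso R (quot (fmod (D \<alpha>)) (C \<alpha>)) (Q \<alpha>)"
    using L by (intro rat_module.first_isomorphism[OF rat_module_fmod[OF subring rsub_D] P.quot.rat_module_axioms L(1)])
      simp_all
  then show ?thesis using True by blast
next
  case False
  have "free R (quot (fmod (C \<alpha>)) (C \<alpha>))"
    by (rule rat_module.quot_self_free[OF rat_module_fmod[OF subring rsub_C]])
      (simp_all add: submodule_fmod rsub_C)
  then show ?thesis using D_bad[OF False] by simp
qed

text \<open>A maximal independent subset of \<open>X\<close> is finite and lies in one member of the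
  chain, and purity extends the inclusion to all of \<open>X\<close>. The exception
  \<open>X = {0}\<close> is needed because \<open>\<Delta>\<close> may be empty.\<close>

lemma finite_rank_subset_D:
  assumes X: "rsub R X" "X \<subseteq> G" "rank_le R (fmod X) n" and \<Delta>: "X \<subseteq> {0} \<union> (\<Union>\<delta>\<in>\<Delta>. D \<delta>)"
  shows "X = {0} \<or> (\<exists>\<delta>\<in>\<Delta>. X \<subseteq> D \<delta>)"
proof -
  obtain T where T: "T \<subseteq> X" "fv.independent T" "X \<subseteq> fv.span T"
    using fv.maximal_independent_subset[of X] by blast
  have "finite T" using X(3) indep_fmod_if_independent[OF T(1,2)] by (auto simp: rank_le_def)
  have "\<exists>\<delta>\<in>\<Delta>. S \<subseteq> D \<delta>" if "finite S" "S \<noteq> {}" "S \<subseteq> T" for S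
    using that
  proof (induction rule: finite_ne_induct)
    case (singleton x)
    then have "x \<noteq> 0" using T(2) fv.dependent_zero by blast
    then show ?case using \<Delta> T(1) singleton by blast
  next
    case (insert x S)
    then obtain \<delta> where \<delta>: "\<delta> \<in> \<Delta>" "S \<subseteq> D \<delta>" by blast
    have "x \<noteq> 0" using insert.prems T(2) fv.dependent_zero by blast
    then obtain \<epsilon> where \<epsilon>: "\<epsilon> \<in> \<Delta>" "x \<in> D \<epsilon>" using \<Delta> T(1) insert.prems by blast
    from \<delta> \<epsilon> show ?case using D_mono ord.linear[of \<delta> \<epsilon>] by blast
  qed
  then consider "T = {}" | \<delta> where "\<delta> \<in> \<Delta>" "T \<subseteq> D \<delta>" using \<open>finite T\<close> by blast
  then show ?thesis
  proof cases
    case 1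
    then show ?thesis using T(3) rsubD(1)[OF X(1)] by auto
  next
    case 2
    have "x \<in> D \<delta>" if "x \<in> X" for x
    proof -
      have "x \<in> fv.span (D \<delta>)" using T(3) fv.span_mono[OF 2(2)] that by blast
      then obtain r where "r \<noteq> 0" "fsc r x \<in> D \<delta>" using span_clear_denominator[OF subring rsub_D] by blast
      then show ?thesis using D_pure X(2) that by blast
    qed
    then show ?thesis using 2(1) by blast
  qed
qed

lemma finite_rank_free:
  assumes S: "rsub R S" "S \<subseteq> G" "rank_le R (fmod S) n"
    and free: "\<And>\<alpha> T. submodule R (Q \<alpha>) T \<Longrightarrow> rank_le R (submod (Q \<alpha>) T) n \<Longrightarrow> free R (submod (Q \<alpha>) T)"
  shows "free R (fmod S)"
proof -
  have D: "free R (fmod (S \<inter> D \<alpha>))" for \<alpha>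
  proof (induction \<alpha> rule: ord.less_induct)
    case (less \<alpha>)
    have C: "free R (fmod (S \<inter> C \<alpha>))"
    proof -
      have "S \<inter> C \<alpha> \<subseteq> {0} \<union> (\<Union>\<delta>\<in>{\<delta>. \<delta> \<sqsubset> \<alpha>}. D \<delta>)" using C_cases by blast
      then consider "S \<inter> C \<alpha> = {0}" | \<delta> where "\<delta> \<sqsubset> \<alpha>" "S \<inter> C \<alpha> \<subseteq> D \<delta>"
        using finite_rank_subset_D[of "S \<inter> C \<alpha>" n "{\<delta>. \<delta> \<sqsubset> \<alpha>}"] S rsub_inter[OF S(1) rsub_C]
          rank_le_fmod_mono[OF S(3), of "S \<inter> C \<alpha>"] by blast
      then show ?thesis
      proof cases
        case 1
        then show ?thesis using free_fmod_zero by simp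
      next
        case 2
        then have "S \<inter> C \<alpha> = S \<inter> D \<delta>" using D_subset_C by blast
        then show ?thesis using less.IH[OF 2(1)] by simp
      qed
    qed
    show ?case
    proof (cases "good \<alpha>")
      case True
      interpret P: presentation R "num \<alpha>" "pp \<alpha>" "kk \<alpha>" by (rule pres)
      obtain L where L: "rlinear R (fmod (D \<alpha>)) (Q \<alpha>) L" "C \<alpha> = {x \<in> D \<alpha>. L x = mzero (Q \<alpha>)}"
        using step_map[OF True] .
      have M: "rat_module R (fmod (S \<inter> D \<alpha>))"
        by (rule rat_module_fmod[OF subring rsub_inter[OF S(1) rsub_D]])
      have lin: "rlinear R (fmod (S \<inter> D \<alpha>)) (Q \<alpha>) L" using L(1) by (auto simp: rlinear_def)
      have "rank_le R (fmod (S \<inter> D \<alpha>)) n" using rank_le_fmod_mono[OF S(3)] by simp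
      then have "free R (submod (Q \<alpha>) (L ` mcarr (fmod (S \<inter> D \<alpha>))))"
        using rank_le_image[OF M P.quot.rat_module_axioms lin]
          submodule_image[OF M P.quot.rat_module_axioms lin] free by blast
      moreover have "S \<inter> C \<alpha> = {x \<in> mcarr (fmod (S \<inter> D \<alpha>)). L x = mzero (Q \<alpha>)}" using L(2) by auto
      ultimately show ?thesis
        using C by (intro free_extension[OF M P.quot.rat_module_axioms lin]) simp_all
    qed (use C D_bad in simp)
  qed
  have "S = {0} \<or> (\<exists>\<delta>\<in>UNIV. S \<subseteq> D \<delta>)"
    using S G_eq by (intro finite_rank_subset_D) auto
  then show ?thesis
  proof
    assume "\<exists>\<delta>\<in>UNIV. S \<subseteq> D \<delta>"
    then obtain \<delta> where "S \<inter> D \<delta> = S" by blast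
    then show ?thesis using D[of \<delta>] by simp
  qed (use free_fmod_zero in simp)
qed

section \<open>Continuity of the chain, independent vectors, extension of homomorphisms\<close>

lemma C_min: assumes "\<And>\<beta>. \<not> \<beta> \<sqsubset> \<alpha>" shows "C \<alpha> = {0}"
  using C_cases[of _ \<alpha>] assms rsubD(1)[OF rsub_C] by blast

lemma C_limit:
  assumes "\<beta> \<sqsubset> \<alpha>" "\<And>\<beta>. \<beta> \<sqsubset> \<alpha> \<Longrightarrow> \<exists>\<gamma>. \<beta> \<sqsubset> \<gamma> \<and> \<gamma> \<sqsubset> \<alpha>"
  shows "C \<alpha> = (\<Union>\<beta>\<in>{\<beta>. \<beta> \<sqsubset> \<alpha>}. C \<beta>)"
proof
  show "C \<alpha> \<subseteq> (\<Union>\<beta>\<in>{\<beta>. \<beta> \<sqsubset> \<alpha>}. C \<beta>)"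
  proof
    fix v assume "v \<in> C \<alpha>"
    then show "v \<in> (\<Union>\<beta>\<in>{\<beta>. \<beta> \<sqsubset> \<alpha>}. C \<beta>)"
    proof (cases rule: C_cases)
      case 1
      then show ?thesis using assms(1) rsubD(1)[OF rsub_C] by blast
    next
      case (2 \<delta>)
      then obtain \<gamma> where \<gamma>: "\<delta> \<sqsubset> \<gamma>" "\<gamma> \<sqsubset> \<alpha>" using assms(2) by blast
      then have "v \<in> C \<gamma>" using 2(2) D_subset_C by blast
      then show ?thesis using \<gamma>(2) by blast
    qed
  qed
qed (use C_mono ord.less_imp_le in blast)

lemma C_succ:
  assumes "\<beta> \<sqsubset> \<alpha>" "\<And>\<gamma>. \<beta> \<sqsubset> \<gamma> \<Longrightarrow> \<not> \<gamma> \<sqsubset> \<alpha>"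
  shows "C \<alpha> = D \<beta>"
proof
  show "C \<alpha> \<subseteq> D \<beta>"
  proof
    fix v assume "v \<in> C \<alpha>"
    then show "v \<in> D \<beta>"
    proof (cases rule: C_cases)
      case 1
      then show ?thesis using rsubD(1)[OF rsub_D] by blast
    next
      case (2 \<delta>)
      then have "\<delta> \<sqsubseteq> \<beta>" using assms(2) ord.not_le by blast
      then show ?thesis using 2 D_mono by blast
    qed
  qed
qed (rule D_subset_C[OF assms(1)])

lemma e0_in_G: "good \<alpha> \<Longrightarrow> e \<alpha> 0 \<in> G"
proof -
  assume "good \<alpha>"
  then have "gn \<alpha> (Inr 0) \<in> D \<alpha>" by (intro gn_in_D) auto
  moreover have "gn \<alpha> (Inr 0) = e \<alpha> 0"
    by (simp add: gn_def presentation.gens_simps[OF pres] presentation.ygen.simps[OF pres])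
  ultimately show ?thesis using D_subset_G by auto
qed

lemma inj_e0: "inj (\<lambda>\<alpha>. e \<alpha> 0)"
  by (rule injI) (metis e_apply zero_neq_one)

text \<open>The coefficient of \<open>e \<alpha> 0\<close> in a combination is its entry at the
  coordinate \<open>b (\<alpha>, 0)\<close>. With many good indices this bounds the rank from
  below.\<close>

lemma indep_e0: "indep R (fmod G) ((\<lambda>\<alpha>. e \<alpha> 0) ` Collect good)"
  unfolding indep_iff_fun
proof (intro conjI allI impI ballI)
  fix xs c x
  assume xs: "distinct xs" "set xs \<subseteq> (\<lambda>\<alpha>. e \<alpha> 0) ` Collect good"
    "lincomb (fmod G) (map c xs) xs = mzero (fmod G)" "x \<in> set xs"
  obtain \<alpha> where \<alpha>: "x = e \<alpha> 0" using xs by blast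
  have at: "y (b (\<alpha>, 0)) = (if y = x then 1 else 0)" if "y \<in> set xs" for y
    using that xs(2) inj_e0 \<alpha> by (auto simp: e_apply inj_def)
  have "(\<Sum>y\<in>set xs. c y * y (b (\<alpha>, 0))) = (\<Sum>y\<in>set xs. if y = x then c y else 0)"
  proof (rule sum.cong[OF refl])
    fix y assume "y \<in> set xs"
    from at[OF this] show "c y * y (b (\<alpha>, 0)) = (if y = x then c y else 0)" by simp
  qed
  also have "\<dots> = c x" using xs(4) by simp
  also have "(\<Sum>y\<in>set xs. c y * y (b (\<alpha>, 0))) = lincomb (fmod G) (map c xs) xs (b (\<alpha>, 0))"
    using xs(1) by (simp add: lincomb_fmod_sum sum_fun_apply)
  finally show "c x = 0" using xs(3) by simp
qed (use e0_in_G in auto)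

text \<open>The extension is \<open>F \<alpha>\<close>: it agrees with \<open>\<phi>\<close> on the
  relators, hence on \<open>N \<alpha>\<close>, and its values lie in \<open>G\<close> because the
  generators entered the chain at the good index \<open>\<alpha>\<close>.\<close>

lemma extend_hom:
  assumes "good \<alpha>" "rlinear R (submod (B \<alpha>) (N \<alpha>)) (fmod G) \<phi>"
    and "\<And>m. \<phi> (Ngen (enat (num \<alpha>)) (pp \<alpha>) (kk \<alpha>) m) = \<psi> \<alpha> m"
  shows "\<exists>f. rlinear R (B \<alpha>) (fmod G) f \<and> (\<forall>x\<in>N \<alpha>. f x = \<phi> x)"
proof (intro exI conjI ballI)
  interpret P: presentation R "num \<alpha>" "pp \<alpha>" "kk \<alpha>" by (rule pres)
  show lin: "rlinear R (B \<alpha>) (fmod G) (F \<alpha>)"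
    by (rule P.rlinear_eval_gens[OF rsub_G]) (use gn_in_D[OF assms(1)] D_subset_G in blast)+
  fix x assume "x \<in> N \<alpha>"
  have "rlinear R (submod (B \<alpha>) (N \<alpha>)) (fmod G) (F \<alpha>)"
    by (rule rlinear_submod[OF lin P.N_subset_B])
  then show "F \<alpha> x = \<phi> x"
    by (rule P.rlinear_eq_on_N[OF rat_module_fmod[OF subring rsub_G] _ assms(2) _ \<open>x \<in> N \<alpha>\<close>])
      (simp add: assms(3) gn_def P.eval_rel)
qed

end

section \<open>Enumeration and cofinality\<close>

unbundle cardinal_syntax

lemma infinite_Times_bij:
  assumes "infinite (UNIV :: 'k set)" shows "\<exists>t :: 'k \<Rightarrow> 'k \<times> 'k. bij t"
proof -
  have "|UNIV \<times> UNIV :: ('k \<times> 'k) set| =o |UNIV :: 'k set|"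
    using assms by (rule card_of_Times_same_infinite)
  then have "|UNIV :: 'k set| =o |UNIV \<times> UNIV :: ('k \<times> 'k) set|" by (rule ordIso_symmetric)
  then show ?thesis unfolding card_of_ordIso[symmetric] by simp
qed

lemma surj_sequences:
  assumes "|Func (UNIV :: nat set) (UNIV :: 'k set)| =o |UNIV :: 'k set|"
  shows "\<exists>c :: 'k \<Rightarrow> nat \<Rightarrow> 'k. surj c"
proof -
  have "Func (UNIV :: nat set) (UNIV :: 'k set) = UNIV" by (auto simp: Func_def)
  then have "|UNIV :: 'k set| =o |UNIV :: (nat \<Rightarrow> 'k) set|" using assms ordIso_symmetric by metis
  then show ?thesis unfolding card_of_ordIso[symmetric] by (auto simp: bij_betw_def)
qed

text \<open>An index is decoded by the pairing \<open>t\<close> into a triple: one part names the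
  presentation, one the sequence of functions, and the remaining part is ignored, so that every task
  recurs once for each index.\<close>

lemma enumeration:
  fixes \<Phi> :: "'d set"
  assumes inf: "infinite (UNIV :: 'k set)"
    and pow: "|Func (UNIV :: nat set) (UNIV :: 'k set)| =o |UNIV :: 'k set|"
    and \<Phi>: "|\<Phi>| \<le>o |UNIV :: 'k set|" "\<Phi> \<noteq> {}"
  obtains d :: "'k \<Rightarrow> 'd" and \<psi> :: "'k \<Rightarrow> nat \<Rightarrow> 'k \<Rightarrow> rat" where "range d \<subseteq> \<Phi>"
    "\<forall>\<delta>\<in>\<Phi>. \<forall>\<phi>. (\<forall>m. finite {x. \<phi> m x \<noteq> 0}) \<longrightarrow>
      |UNIV :: 'k set| \<le>o |{\<alpha>. d \<alpha> = \<delta> \<and> \<psi> \<alpha> = \<phi>}|"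
    "|{v :: 'k \<Rightarrow> rat. finite {x. v x \<noteq> 0}}| \<le>o |UNIV :: 'k set|"
proof -
  obtain c :: "'k \<Rightarrow> nat \<Rightarrow> 'k" where c: "surj c" using surj_sequences[OF pow] by blast
  obtain t :: "'k \<Rightarrow> 'k \<times> 'k" where t: "bij t" using infinite_Times_bij[OF inf] by blast
  obtain g :: "'k \<Rightarrow> 'd" where g: "range g = \<Phi>"
    using \<Phi> card_of_ordLeq2[of \<Phi> "UNIV :: 'k set"] by blast
  have "|UNIV :: nat set| \<le>o |UNIV :: 'k set|" using inf infinite_iff_card_of_nat by blast
  then obtain \<nu> :: "'k \<Rightarrow> nat" where \<nu>: "surj \<nu>"
    using card_of_ordLeq2[of "UNIV :: nat set" "UNIV :: 'k set"] by blast
  define q :: "'k \<Rightarrow> rat" where "q = from_nat \<circ> \<nu>"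
  have q: "surj q" unfolding q_def using \<nu> surj_from_nat by (rule comp_surj)
  \<comment> \<open>A sequence of indices is read as a list of pairs of a position and a value;
    positions that are not listed get the value 0. If a position is listed repeatedly, one entry is
    chosen.\<close>
  define dec :: "(nat \<Rightarrow> 'k) \<Rightarrow> 'k \<Rightarrow> rat" where
    "dec s x = (if \<exists>i. fst (t (s i)) = x then q (snd (t (s (SOME i. fst (t (s i)) = x)))) else 0)" for s x
  have dec: "\<exists>s. dec s = v" if fin: "finite {x. v x \<noteq> 0}" for v
  proof -
    have "\<exists>a :: nat \<Rightarrow> 'k. {x. v x \<noteq> 0} \<subseteq> range a"
    proof (cases "{x. v x \<noteq> 0} = {}")
      case False
      then show ?thesis using range_from_nat_into[OF False countable_finite[OF fin]] by blast
    qed simp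
    then obtain a :: "nat \<Rightarrow> 'k" where a: "{x. v x \<noteq> 0} \<subseteq> range a" by blast
    define s where "s i = inv t (a i, inv q (v (a i)))" for i
    have ts: "t (s i) = (a i, inv q (v (a i)))" for i
      using t by (simp add: s_def bij_is_surj surj_f_inv_f)
    have "dec s x = v x" for x
    proof (cases "\<exists>i. a i = x")
      case True
      then have "a (SOME i. a i = x) = x" by (rule someI_ex)
      then show ?thesis using True q by (simp add: dec_def ts surj_f_inv_f)
    next
      case False
      then show ?thesis using a by (auto simp: dec_def ts)
    qed
    then show ?thesis by blast
  qed
  define d where "d \<alpha> = g (fst (t (snd (t \<alpha>))))" for \<alpha>
  \<comment> \<open>The surjection \<open>c\<close> is used twice: once to unpack a sequence of
    codes, and once to unpack each code into the sequence that \<open>dec\<close> reads as a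
    function.\<close>
  define \<psi> where "\<psi> \<alpha> = (\<lambda>m. dec (c (c (snd (t (snd (t \<alpha>)))) m)))" for \<alpha>
  show ?thesis
  proof (rule that; (intro ballI allI impI)?)
    show "range d \<subseteq> \<Phi>" using g by (auto simp: d_def)
  next
    fix \<delta> :: 'd and \<phi> :: "nat \<Rightarrow> 'k \<Rightarrow> rat"
    assume \<delta>: "\<delta> \<in> \<Phi>" and \<phi>: "\<forall>m. finite {x. \<phi> m x \<noteq> 0}"
    obtain u where u: "g u = \<delta>" using g \<delta> by blast
    have "\<forall>m. \<exists>z. dec (c z) = \<phi> m" using dec \<phi> c by (metis surjD)
    then obtain z where z: "\<And>m. dec (c (z m)) = \<phi> m" by metis
    obtain w where w: "c w = z" using c by (metis surjD)
    \<comment> \<open>The free component \<open>j\<close> injects all indices into the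
      fibre.\<close>
    define f where "f j = inv t (j, inv t (u, w))" for j
    have tf: "t (f j) = (j, inv t (u, w))" for j
      using t by (simp add: f_def bij_is_surj surj_f_inv_f)
    have "f ` UNIV \<subseteq> {\<alpha>. d \<alpha> = \<delta> \<and> \<psi> \<alpha> = \<phi>}"
      using t u w z by (auto simp: d_def \<psi>_def tf bij_is_surj surj_f_inv_f)
    moreover have "inj f" by (rule injI) (metis tf fst_conv)
    ultimately show "|UNIV :: 'k set| \<le>o |{\<alpha>. d \<alpha> = \<delta> \<and> \<psi> \<alpha> = \<phi>}|"
      unfolding card_of_ordLeq[symmetric] by blast
  next
    have "{v :: 'k \<Rightarrow> rat. finite {x. v x \<noteq> 0}} \<subseteq> range (dec \<circ> c)"
      using dec c by (auto simp: surj_def) (metis rangeI)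
    then have "|{v :: 'k \<Rightarrow> rat. finite {x. v x \<noteq> 0}}| \<le>o |range (dec \<circ> c)|" by (rule card_of_mono1)
    then show "|{v :: 'k \<Rightarrow> rat. finite {x. v x \<noteq> 0}}| \<le>o |UNIV :: 'k set|"
      using card_of_image ordLeq_transitive by blast
  qed
qed

text \<open>An unbounded sequence would be cofinal, so regularity would make the cardinal countable.
  Then its sequences could be listed by the natural numbers, against the diagonal argument.\<close>

lemma countable_bounded:
  assumes inf: "infinite (UNIV :: 'k set)"
    and pow: "|Func (UNIV :: nat set) (UNIV :: 'k set)| =o |UNIV :: 'k set|"
    and reg: "regularCard |UNIV :: 'k set|"
  shows "\<exists>\<beta>. \<forall>m :: nat. (a m, \<beta>) \<in> |UNIV :: 'k set|"
proof (rule ccontr)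
  let ?r = "|UNIV :: 'k set|"
  assume "\<not> ?thesis"
  moreover have tot: "(x, y) \<in> ?r \<or> (y, x) \<in> ?r" for x y
    using card_of_Well_order[of "UNIV :: 'k set"]
    by (cases "x = y") (auto simp: well_order_on_def linear_order_on_def partial_order_on_def
      preorder_on_def total_on_def refl_on_def Field_card_of)
  ultimately have "cofinal (range a) ?r"
    unfolding cofinal_def using tot by (metis rangeI)
  then have "|range a| =o ?r" using reg unfolding regularCard_def by (simp add: Field_card_of)
  then have "?r \<le>o |range a|" using ordIso_iff_ordLeq by blast
  then have "?r \<le>o |UNIV :: nat set|" using card_of_image ordLeq_transitive by blast
  then obtain h :: "nat \<Rightarrow> 'k" where h: "surj h"
    using card_of_ordLeq2[of "UNIV :: 'k set" "UNIV :: nat set"] by blast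
  obtain c :: "'k \<Rightarrow> nat \<Rightarrow> 'k" where c: "surj c" using surj_sequences[OF pow] by blast
  have "UNIV \<noteq> {undefined :: 'k}" using inf by (metis finite.emptyI finite.insertI)
  then obtain x y :: 'k where xy: "x \<noteq> y" by blast
  \<comment> \<open>The sequence changed along the diagonal is itself coded, by some
    \<open>h i\<close>, and contradicts its own value at \<open>i\<close>.\<close>
  obtain i where "c (h i) = (\<lambda>n. if c (h n) n = x then y else x)" using h c by (metis surjD)
  then have "c (h i) i = (if c (h i) i = x then y else x)" by metis
  then show False using xy by (auto split: if_splits)
qed

text \<open>A set without elements from \<open>\<beta>\<close> on lies in a proper initial segment,
  and proper initial segments of a cardinal are smaller than it.\<close>

lemma large_cofinal:
  assumes "|UNIV :: 'k set| \<le>o |A|"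
  shows "\<exists>\<alpha>\<in>A. (\<beta>, \<alpha>) \<in> |UNIV :: 'k set|"
proof (rule ccontr)
  let ?r = "|UNIV :: 'k set|"
  assume no: "\<not> ?thesis"
  have "A \<subseteq> underS ?r \<beta>"
  proof
    fix \<alpha> assume "\<alpha> \<in> A"
    then have "(\<beta>, \<alpha>) \<notin> ?r" using no by blast
    then show "\<alpha> \<in> underS ?r \<beta>"
      using card_of_Well_order[of "UNIV :: 'k set"]
      by (cases "\<alpha> = \<beta>") (auto simp: underS_def well_order_on_def linear_order_on_def
        partial_order_on_def preorder_on_def total_on_def refl_on_def Field_card_of)
  qed
  then have "|A| \<le>o |underS ?r \<beta>|" by (rule card_of_mono1)
  moreover have "|underS ?r \<beta>| <o ?r"
    by (rule card_of_underS[OF card_of_Card_order]) (simp add: Field_card_of)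
  ultimately have "|A| <o ?r" by (rule ordLeq_ordLess_trans)
  then show False using assms not_ordLess_ordLeq by blast
qed

lemma wellorder_card_of:
  "class.wellorder (\<lambda>a b. (a, b) \<in> |UNIV :: 'k set| ) (\<lambda>a b. a \<noteq> b \<and> (a, b) \<in> |UNIV :: 'k set| )"
proof -
  let ?r = "|UNIV :: 'k set|"
  have wo: "Well_order ?r" by (rule card_of_Well_order)
  then have r: "refl ?r" "trans ?r" "antisym ?r" "total ?r" "wf (?r - Id)"
    by (simp_all add: well_order_on_def linear_order_on_def partial_order_on_def
      preorder_on_def Field_card_of)
  show ?thesis
  proof
    fix a b c
    show "(a \<noteq> b \<and> (a, b) \<in> ?r) = ((a, b) \<in> ?r \<and> (b, a) \<notin> ?r)"
      using r(1,3) by (auto simp: antisym_def refl_on_def)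
    show "(a, a) \<in> ?r" using r(1) by (simp add: refl_on_def)
    show "(a, c) \<in> ?r" if "(a, b) \<in> ?r" "(b, c) \<in> ?r" using r(2) that by (rule transD)
    show "a = b" if "(a, b) \<in> ?r" "(b, a) \<in> ?r" using r(3) that by (rule antisymD)
    show "(a, b) \<in> ?r \<or> (b, a) \<in> ?r" using r(1,4) by (cases "a = b") (auto simp: total_on_def refl_on_def)
  next
    fix P :: "'k \<Rightarrow> bool" and a
    assume step: "\<And>x. (\<And>y. y \<noteq> x \<and> (y, x) \<in> ?r \<Longrightarrow> P y) \<Longrightarrow> P x"
    show "P a" using r(5)
    proof (induction a rule: wf_induct_rule)
      case (less x)
      then show ?case by (rule step) auto
    qed
  qed
qed

section \<open>Representation and rank\<close>

context tower
begin

text \<open>The chain has to be indexed by elements of the type of \<open>G\<close>, so the order of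
  the indices is transported along the injection sending \<open>\<alpha>\<close> to
  \<open>e \<alpha> 0\<close>.\<close>

lemma Phi_represented_G:
  assumes r: "Well_order r" "Field r = UNIV" and le: "\<And>\<alpha> \<beta>. \<alpha> \<sqsubseteq> \<beta> \<longleftrightarrow> (\<alpha>, \<beta>) \<in> r"
    and d: "\<And>\<alpha>. (num \<alpha>, pp \<alpha>, kk \<alpha>) \<in> \<Phi>"
  shows "Phi_represented R \<Phi> (fmod G)"
proof -
  define \<iota> where "\<iota> \<alpha> = e \<alpha> 0" for \<alpha>
  have inj: "inj \<iota>" unfolding \<iota>_def by (rule inj_e0)
  define W where "W = dir_image r \<iota>"
  define c where "c z = C (inv \<iota> z)" for z
  have c: "c (\<iota> \<alpha>) = C \<alpha>" for \<alpha> by (simp add: c_def inj)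
  have W: "(\<iota> \<alpha>, \<iota> \<beta>) \<in> W \<longleftrightarrow> \<alpha> \<sqsubseteq> \<beta>" for \<alpha> \<beta>
    using inj by (auto simp: W_def dir_image_def le inj_def)
  have FW: "Field W = range \<iota>" by (simp add: W_def dir_image_Field r)
  have lt: "wlt W (\<iota> \<alpha>) (\<iota> \<beta>) \<longleftrightarrow> \<alpha> \<sqsubset> \<beta>" for \<alpha> \<beta>
    using inj by (auto simp: wlt_def W inj_def ord.less_le)
  have FI: "\<exists>\<alpha>. z = \<iota> \<alpha>" if "z \<in> Field W" for z using that FW by blast
  have wlt_Field: "z \<in> Field W \<and> z' \<in> Field W" if "wlt W z z'" for z z'
    using that by (auto simp: wlt_def Field_def)
  show ?thesis unfolding Phi_represented_def
  proof (intro exI[of _ W] exI[of _ c] conjI allI ballI impI)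
    show "Well_order W" unfolding W_def
      using r inj by (intro Well_order_dir_image) auto
  next
    fix z assume "z \<in> Field W"
    then obtain \<alpha> where "z = \<iota> \<alpha>" using FI by blast
    then show "submodule R (fmod G) (c z)"
      using rsub_C by (auto simp: c submodule_fmod G_def)
  next
    fix z z' assume *: "(z, z') \<in> W"
    then obtain \<alpha> \<beta> where "z = \<iota> \<alpha>" "z' = \<iota> \<beta>" using FI by (meson FieldI1 FieldI2)
    then show "c z \<subseteq> c z'" using * C_mono by (simp add: c W)
  next
    show "(\<Union>z\<in>Field W. c z) = mcarr (fmod G)" by (simp add: FW c G_def)
  next
    fix z assume z: "wmin W z"
    then obtain \<alpha> where \<alpha>: "z = \<iota> \<alpha>" using FI by (auto simp: wmin_def)
    have "\<not> \<beta> \<sqsubset> \<alpha>" for \<beta>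
    proof -
      have "(\<iota> \<alpha>, \<iota> \<beta>) \<in> W" using z \<alpha> FW by (simp add: wmin_def)
      then show ?thesis by (simp add: W ord.not_less)
    qed
    then show "c z = {mzero (fmod G)}" using C_min \<alpha> by (simp add: c)
  next
    fix z assume z: "wlimit W z"
    then obtain \<alpha> where \<alpha>: "z = \<iota> \<alpha>" using FI by (auto simp: wlimit_def)
    have "\<exists>\<beta>. \<not> \<alpha> \<sqsubseteq> \<beta>"
    proof (rule ccontr)
      assume "\<not> ?thesis"
      then have "wmin W z" using \<alpha> by (auto simp: wmin_def FW W)
      then show False using z by (simp add: wlimit_def)
    qed
    then obtain \<beta> where \<beta>: "\<beta> \<sqsubset> \<alpha>" using ord.not_le by blast
    have "\<exists>\<gamma>. \<beta> \<sqsubset> \<gamma> \<and> \<gamma> \<sqsubset> \<alpha>" if b: "\<beta> \<sqsubset> \<alpha>" for \<beta>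
    proof -
      have "\<not> wsucc W (\<iota> \<beta>) z" using z by (simp add: wlimit_def)
      then obtain y where y: "wlt W (\<iota> \<beta>) y" "wlt W y z" using b \<alpha> by (auto simp: wsucc_def lt)
      then obtain \<gamma> where "y = \<iota> \<gamma>" using FI wlt_Field by blast
      then show ?thesis using y \<alpha> by (auto simp: lt)
    qed
    then have C: "C \<alpha> = (\<Union>\<beta>\<in>{\<beta>. \<beta> \<sqsubset> \<alpha>}. C \<beta>)" by (rule C_limit[OF \<beta>])
    have "{y. wlt W y z} = \<iota> ` {\<beta>. \<beta> \<sqsubset> \<alpha>}"
    proof
      show "{y. wlt W y z} \<subseteq> \<iota> ` {\<beta>. \<beta> \<sqsubset> \<alpha>}"
      proof
        fix y assume "y \<in> {y. wlt W y z}"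
        then have y: "wlt W y z" by simp
        then obtain \<gamma> where "y = \<iota> \<gamma>" using FI wlt_Field by blast
        then show "y \<in> \<iota> ` {\<beta>. \<beta> \<sqsubset> \<alpha>}" using y \<alpha> by (simp add: lt)
      qed
    qed (auto simp: lt \<alpha>)
    then show "c z = (\<Union>y\<in>{y. wlt W y z}. c y)" using C by (simp add: \<alpha> c)
  next
    fix z y assume s: "wsucc W y z"
    then obtain \<alpha> \<beta> where \<alpha>: "z = \<iota> \<alpha>" "y = \<iota> \<beta>" using FI wlt_Field unfolding wsucc_def by meson
    have "\<beta> \<sqsubset> \<alpha>" using s \<alpha> by (simp add: wsucc_def lt)
    moreover have "\<not> \<gamma> \<sqsubset> \<alpha>" if "\<beta> \<sqsubset> \<gamma>" for \<gamma>
    proof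
      assume "\<gamma> \<sqsubset> \<alpha>"
      then have "wlt W y (\<iota> \<gamma>) \<and> wlt W (\<iota> \<gamma>) z" using that by (simp add: \<alpha> lt)
      then show False using s unfolding wsucc_def by blast
    qed
    ultimately have CD: "C \<alpha> = D \<beta>" by (rule C_succ)
    have "free R (quot (fmod (D \<beta>)) (C \<beta>)) \<or> (\<exists>d\<in>\<Phi>. iso R (quot (fmod (D \<beta>)) (C \<beta>)) (pmod R d))"
      using step_quotient[of \<beta>] bexI[OF _ d[of \<beta>], of "\<lambda>d. iso R (quot (fmod (D \<beta>)) (C \<beta>)) (pmod R d)"]
      by auto
    then show "free R (quot (submod (fmod G) (c z)) (c y)) \<or>
        (\<exists>d\<in>\<Phi>. iso R (quot (submod (fmod G) (c z)) (c y)) (pmod R d))"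
      by (simp add: \<alpha> c CD)
  qed
qed

lemma has_rank_G:
  assumes good: "|UNIV :: 'k set| \<le>o |Collect good|"
    and fin: "|{v :: 'k \<Rightarrow> rat. finite {x. v x \<noteq> 0}}| \<le>o |UNIV :: 'k set|"
  shows "has_rank R (fmod G) |UNIV :: 'k set|"
proof -
  have le: "|S| \<le>o |UNIV :: 'k set|" if "indep R (fmod G) S" for S
  proof -
    have "S \<subseteq> {v. finite {x. v x \<noteq> 0}}" using that finite_support by (auto simp: indep_def)
    then show ?thesis using fin card_of_mono1 ordLeq_transitive by blast
  qed
  let ?S = "(\<lambda>\<alpha>. e \<alpha> 0) ` Collect good"
  have "inj_on (\<lambda>\<alpha>. e \<alpha> 0) (Collect good)" using inj_e0 by (rule inj_on_subset) simp
  then have "|Collect good| \<le>o |?S|" unfolding card_of_ordLeq[symmetric] by blast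
  then have "|UNIV :: 'k set| \<le>o |?S|" using good ordLeq_transitive by blast
  then have "|?S| =o |UNIV :: 'k set|" using le[OF indep_e0] ordIso_iff_ordLeq by blast
  then show ?thesis unfolding has_rank_def using le indep_e0 by blast
qed

end

theorem theorem4p8:
  fixes R :: "rat set" and \<Phi> :: "pdata set"
  assumes "subring_Q R" and "R \<noteq> UNIV"
    and "\<Phi> \<noteq> {}" and "\<forall>d\<in>\<Phi>. fin_free_by_1 R d"
    and "infinite (UNIV :: 'k set)"
    and "regularCard (card_of (UNIV :: 'k set))"
    and "(card_of (Func (UNIV :: nat set) (UNIV :: 'k set)), card_of (UNIV :: 'k set)) \<in> ordIso"
    and "(card_of \<Phi>, card_of (UNIV :: 'k set)) \<in> ordLess"
  shows "\<exists>G :: ('k \<Rightarrow> rat) rmod.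
           rmodule R G \<and> torsion_free R G \<and> Phi_complete R \<Phi> G \<and> Phi_represented R \<Phi> G \<and>
           has_rank R G (card_of (UNIV :: 'k set)) \<and>
           (\<forall>n::nat. (\<forall>d\<in>\<Phi>. \<not> rank_le R (pmod R d) n) \<longrightarrow>
              (\<forall>S. submodule R G S \<and> rank_le R (submod G S) n \<longrightarrow> free R (submod G S)))"
proof -
  note R = assms(1) and inf = assms(5) and reg = assms(6) and pow = assms(7)
  let ?r = "|UNIV :: 'k set|"
  obtain d :: "'k \<Rightarrow> pdata" and \<psi> :: "'k \<Rightarrow> nat \<Rightarrow> 'k \<Rightarrow> rat" where d: "range d \<subseteq> \<Phi>"
    and fibre: "\<forall>\<delta>\<in>\<Phi>. \<forall>\<phi>. (\<forall>m. finite {x. \<phi> m x \<noteq> 0}) \<longrightarrow> ?r \<le>o |{\<alpha>. d \<alpha> = \<delta> \<and> \<psi> \<alpha> = \<phi>}|"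
    and fin: "|{v :: 'k \<Rightarrow> rat. finite {x. v x \<noteq> 0}}| \<le>o ?r"
    by (rule enumeration[OF inf pow ordLess_imp_ordLeq[OF assms(8)] assms(3)])
  define num where "num \<alpha> = fst (d \<alpha>)" for \<alpha>
  define pp where "pp \<alpha> = fst (snd (d \<alpha>))" for \<alpha>
  define kk where "kk \<alpha> = snd (snd (d \<alpha>))" for \<alpha>
  have d_eq: "d \<alpha> = (num \<alpha>, pp \<alpha>, kk \<alpha>)" for \<alpha> by (simp add: num_def pp_def kk_def)
  have d_in: "(num \<alpha>, pp \<alpha>, kk \<alpha>) \<in> \<Phi>" for \<alpha> using d d_eq[of \<alpha>] by (metis rangeI subsetD)
  then have nfb: "n_free_by_1 R (enat (num \<alpha>)) (pp \<alpha>) (kk \<alpha>)" for \<alpha>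
    using assms(4) fin_free_by_1.simps by blast
  \<comment> \<open>An infinite cardinal absorbs a countable factor, so every index can own
    countably many coordinates.\<close>
  have "|UNIV :: nat set| \<le>o ?r" using inf infinite_iff_card_of_nat by blast
  then have "|(UNIV :: 'k set) \<times> (UNIV :: nat set)| =o ?r"
    using card_of_Times_infinite[OF inf, of "UNIV :: nat set"] by simp
  then have "|(UNIV :: 'k set) \<times> (UNIV :: nat set)| \<le>o ?r" using ordIso_iff_ordLeq by blast
  then obtain b :: "'k \<times> nat \<Rightarrow> 'k" where b: "inj b"
    unfolding card_of_ordLeq[symmetric] UNIV_Times_UNIV by blast
  interpret tower "\<lambda>\<alpha> \<beta>. (\<alpha>, \<beta>) \<in> ?r" "\<lambda>\<alpha> \<beta>. \<alpha> \<noteq> \<beta> \<and> (\<alpha>, \<beta>) \<in> ?r" R num pp kk \<psi> b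
  proof (intro tower.intro tower_axioms.intro wellorder_card_of R b)
    fix \<alpha>
    show "valid_data R (enat (num \<alpha>)) (pp \<alpha>) (kk \<alpha>)" using nfb by (simp add: n_free_by_1_def)
    show "\<exists>\<beta>. \<alpha> \<noteq> \<beta> \<and> (\<alpha>, \<beta>) \<in> ?r"
      using infinite_Card_order_limit[OF card_of_Card_order[of "UNIV :: 'k set"], of \<alpha>] inf
      by (simp add: Field_card_of)
  qed
  have rmod: "rat_module R (fmod G)" by (rule rat_module_fmod[OF R rsub_G])
  have complete: "ext_zero R \<delta> (fmod G)" if \<delta>: "\<delta> \<in> \<Phi>" for \<delta>
  proof -
    obtain n p k where npk: "\<delta> = (n, p, k)" by (cases \<delta>)
    have "presentation R n p k"
      using assms(4) \<delta> R by (auto simp: npk presentation_def n_free_by_1_def)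
    then interpret P: presentation R n p k .
    show ?thesis unfolding npk ext_zero.simps
    proof (intro allI impI)
      fix \<phi> assume \<phi>: "rlinear R (submod P.B P.N) (fmod G) \<phi>"
      have \<phi>G: "\<phi> (P.rel m) \<in> G" for m
        using \<phi> P.rel_in_N[of m] by (auto simp: rlinear_def)
      then have "\<forall>m. \<exists>\<alpha>. \<phi> (P.rel m) \<in> C \<alpha>" by (simp add: G_def)
      \<comment> \<open>Each value of \<open>\<phi>\<close> on a relator appears at some stage
        \<open>a m\<close>. These stages have a common bound \<open>\<beta>\<close>, and the fibre
        of the task is large enough to contain an index beyond \<open>\<beta>\<close>; that index is
        good.\<close>
      then obtain a where a: "\<forall>m. \<phi> (P.rel m) \<in> C (a m)" by (rule choice[THEN exE])
      obtain \<beta> where \<beta>: "\<forall>m. (a m, \<beta>) \<in> ?r"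
        using countable_bounded[OF inf pow reg, of a] by (rule exE)
      have "?r \<le>o |{\<alpha>. d \<alpha> = \<delta> \<and> \<psi> \<alpha> = (\<lambda>m. \<phi> (P.rel m))}|"
        using fibre \<delta> finite_support \<phi>G by simp
      then obtain \<alpha> where \<alpha>: "d \<alpha> = \<delta>" "\<psi> \<alpha> = (\<lambda>m. \<phi> (P.rel m))" "(\<beta>, \<alpha>) \<in> ?r"
        using large_cofinal[of _ \<beta>] by blast
      have "good \<alpha>" unfolding good_def
      proof
        fix m
        have "C (a m) \<subseteq> C \<alpha>" using C_mono ord.order_trans \<beta> \<alpha>(3) by blast
        then show "\<psi> \<alpha> m \<in> C \<alpha>" using a \<alpha>(2) by auto
      qed
      moreover have "num \<alpha> = n" "pp \<alpha> = p" "kk \<alpha> = k" using \<alpha>(1) d_eq[of \<alpha>] by (simp_all add: npk)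
      ultimately show "\<exists>f. rlinear R P.B (fmod G) f \<and> (\<forall>x\<in>P.N. f x = \<phi> x)"
        using extend_hom[of \<alpha> \<phi>] \<phi> \<alpha>(2) by simp
    qed
  qed
  have rank: "has_rank R (fmod G) ?r"
  proof (rule has_rank_G[OF _ fin])
    obtain \<delta> where "\<delta> \<in> \<Phi>" using assms(3) by blast
    \<comment> \<open>The zero sequence has its values in every stage, so all indices carrying it
      are good.\<close>
    then have "?r \<le>o |{\<alpha>. d \<alpha> = \<delta> \<and> \<psi> \<alpha> = (\<lambda>_. 0)}|" using fibre by simp
    moreover have "{\<alpha>. d \<alpha> = \<delta> \<and> \<psi> \<alpha> = (\<lambda>_. 0)} \<subseteq> Collect good"
    proof
      fix \<alpha> assume "\<alpha> \<in> {\<alpha>. d \<alpha> = \<delta> \<and> \<psi> \<alpha> = (\<lambda>_. 0)}"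
      then have \<psi>: "\<psi> \<alpha> = (\<lambda>_. 0)" by simp
      show "\<alpha> \<in> Collect good" unfolding mem_Collect_eq good_def \<psi>
        by (intro allI rsubD(1)[OF rsub_C])
    qed
    ultimately show "?r \<le>o |Collect good|" using card_of_mono1 ordLeq_transitive by blast
  qed
  have free: "free R (submod (fmod G) S)"
    if n: "\<forall>\<delta>\<in>\<Phi>. \<not> rank_le R (pmod R \<delta>) n" and S: "submodule R (fmod G) S" "rank_le R (submod (fmod G) S) n"
    for n S
  proof -
    have "free R (submod (Q \<alpha>) T)"
      if T: "submodule R (Q \<alpha>) T" "rank_le R (submod (Q \<alpha>) T) n" for \<alpha> T
    proof -
      have "\<not> rank_le R (Q \<alpha>) n" using n d_in[of \<alpha>] pmod.simps by metis
      moreover have "rank_le R (Q \<alpha>) (Suc (num \<alpha>))"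
        by (rule presentation.rank_le_pres_mod[OF pres])
      \<comment> \<open>Rank at most \<open>num \<alpha> + 1\<close> but not at most
        \<open>n\<close> gives \<open>n < num \<alpha> + 1\<close>; the resulting bound is the one
        that the definition of \<open>n_free_by_1\<close> asks for.\<close>
      ultimately have "n \<le> num \<alpha>" unfolding rank_le_def by (meson le_trans not_less_eq_eq)
      then have "rank_le R (submod (Q \<alpha>) T) (num \<alpha>)" using T(2) unfolding rank_le_def by (meson le_trans)
      then show ?thesis using nfb[of \<alpha>] T(1) by (simp add: n_free_by_1_def)
    qed
    then show ?thesis using S finite_rank_free[of S n] by (simp add: submodule_fmod)
  qed
  show ?thesis
  proof (intro exI[of _ "fmod G"] conjI allI impI)
    show "rmodule R (fmod G)" using rmod by (simp add: rat_module_def)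
    show "torsion_free R (fmod G)" unfolding torsion_free_def
      using fv.scale_eq_0_iff by (metis fmod_simps(3,4))
    show "Phi_complete R \<Phi> (fmod G)" using complete by (simp add: Phi_complete_def)
    show "Phi_represented R \<Phi> (fmod G)"
      by (rule Phi_represented_G[OF card_of_Well_order _ _ d_in]) (simp_all add: Field_card_of)
    show "has_rank R (fmod G) ?r" by (rule rank)
  next
    fix n S
    assume "\<forall>d\<in>\<Phi>. \<not> rank_le R (pmod R d) n" "submodule R (fmod G) S \<and> rank_le R (submod (fmod G) S) n"
    then show "free R (submod (fmod G) S)" using free by blast
  qed
qed

end
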